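(* Let $r\geq 2$ be an integer, let $c=r^{-(2r+9)(r+1)}$, let $n\geq e^{2/c}$, and let $G$ be a graph of order $n$. If $\mu(G)>\mu(T_r(n))$, then $G$ contains a (not necessarily induced) subgraph isomorphic to $K_r^{+}(\lfloor c\ln n\rfloor,\ldots,\lfloor c\ln n\rfloor)$ (all $r$ parts of size $\lfloor c\ln n\rfloor$).
   Context: All graphs are finite and simple; $\ln$ is the natural logarithm. For a graph $G$, $\mu(G)$ denotes the largest eigenvalue of the adjacency matrix of $G$. $T_r(n)$ is the $r$-partite Turán graph of order $n$, i.e. the complete $r$-partite graph on $n$ vertices whose part sizes differ by at most one. For integers $s_1\geq 2, s_2,\ldots,s_r\ge 1$, $K_r^{+}(s_1,\ldots,s_r)$ denotes the complete $r$-partite graph with parts of sizes $s_1,\ldots,s_r$ together with one additional edge joining two vertices of the first part. *)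

theory Defs
  imports
    "Graph_Theory.Digraph_Isomorphism"
    "Jordan_Normal_Form.Spectral_Radius"
begin

text \<open>
  A finite simple graph is a \<^const>\<open>pair_graph\<close>: a finite vertex set with a symmetric,
  irreflexive set of arcs, each edge being represented by its two orientations.
\<close>

definition vertex_list :: "'a pair_pre_digraph \<Rightarrow> 'a list" where
  "vertex_list G = (SOME vs. distinct vs \<and> set vs = pverts G)"

definition adjacency_matrix_on :: "'a list \<Rightarrow> 'a pair_pre_digraph \<Rightarrow> real mat" where
  "adjacency_matrix_on vs G = mat (length vs) (length vs)
     (\<lambda>(i, j). if (vs ! i, vs ! j) \<in> parcs G then 1 else 0)"

definition adjacency_matrix :: "'a pair_pre_digraph \<Rightarrow> real mat" where
  "adjacency_matrix G = adjacency_matrix_on (vertex_list G) G"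

definition largest_eigenvalue :: "'a pair_pre_digraph \<Rightarrow> real" where
  "largest_eigenvalue G = Max (spectrum (adjacency_matrix G))"

text \<open>
  The list holds the part sizes; the vertex \<open>(i, j)\<close> is the \<open>j\<close>-th vertex of the \<open>i\<close>-th part.
\<close>

definition complete_multipartite :: "nat list \<Rightarrow> (nat \<times> nat) pair_pre_digraph" where
  "complete_multipartite ss =
     (let V = {(i, j). i < length ss \<and> j < ss ! i}
      in \<lparr> pverts = V, parcs = {(u, v). u \<in> V \<and> v \<in> V \<and> fst u \<noteq> fst v} \<rparr>)"

definition turan_graph :: "nat \<Rightarrow> nat \<Rightarrow> (nat \<times> nat) pair_pre_digraph" where
  "turan_graph r n =
     complete_multipartite (map (\<lambda>i. n div r + (if i < n mod r then 1 else 0)) [0..<r])"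

text \<open>Meaningful only for a first part of size at least two.\<close>

definition complete_multipartite_plus :: "nat list \<Rightarrow> (nat \<times> nat) pair_pre_digraph" where
  "complete_multipartite_plus ss =
     \<lparr> pverts = pverts (complete_multipartite ss),
       parcs = parcs (complete_multipartite ss) \<union> {((0, 0), (0, 1)), ((0, 1), (0, 0))} \<rparr>"

lemma pverts_complete_multipartite:
  "pverts (complete_multipartite ss) = (SIGMA i:{..<length ss}. {..<ss ! i})"
  by (auto simp: complete_multipartite_def Let_def)

lemma parcs_complete_multipartite:
  "parcs (complete_multipartite ss) =
     {(u, v). u \<in> pverts (complete_multipartite ss) \<and> v \<in> pverts (complete_multipartite ss)
        \<and> fst u \<noteq> fst v}"
  by (simp add: complete_multipartite_def Let_def)

lemma finite_pverts_complete_multipartite: "finite (pverts (complete_multipartite ss))"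
  by (simp add: pverts_complete_multipartite)

lemma finite_parcs_complete_multipartite: "finite (parcs (complete_multipartite ss))"
  by (rule finite_subset[of _ "pverts (complete_multipartite ss) \<times> pverts (complete_multipartite ss)"])
    (auto simp: parcs_complete_multipartite finite_pverts_complete_multipartite)

lemma pair_graph_complete_multipartite: "pair_graph (complete_multipartite ss)"
  using finite_pverts_complete_multipartite[of ss] finite_parcs_complete_multipartite[of ss]
  by unfold_locales (auto simp: symmetric_def sym_def parcs_complete_multipartite)

lemma pair_graph_complete_multipartite_plus:
  assumes "ss \<noteq> []" "ss ! 0 \<ge> 2"
  shows "pair_graph (complete_multipartite_plus ss)"
  using assms finite_pverts_complete_multipartite[of ss] finite_parcs_complete_multipartite[of ss]
  by unfold_locales
    (auto simp: complete_multipartite_plus_def symmetric_def sym_def parcs_complete_multipartite,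
     auto simp: pverts_complete_multipartite)

lemma card_complete_multipartite: "card (pverts (complete_multipartite ss)) = sum_list ss"
  by (simp add: pverts_complete_multipartite sum_list_sum_nth atLeast0LessThan)

lemma card_turan_graph:
  assumes "r > 0"
  shows "card (pverts (turan_graph r n)) = n"
proof -
  have "card (pverts (turan_graph r n)) = (\<Sum>i<r. n div r + (if i < n mod r then 1 else 0))"
    by (simp add: turan_graph_def card_complete_multipartite sum_list_sum_nth atLeast0LessThan)
  also have "\<dots> = r * (n div r) + card {i\<in>{..<r}. i < n mod r}"
    by (simp add: sum.distrib flip: sum.inter_filter)
  also have "{i\<in>{..<r}. i < n mod r} = {..<n mod r}"
    using assms mod_less_divisor[of r n] by (auto intro: less_trans)
  finally show ?thesis by simp
qed

lemma vertex_list: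
  assumes "finite (pverts G)"
  shows "distinct (vertex_list G)" "set (vertex_list G) = pverts G"
proof -
  obtain vs where "distinct vs \<and> set vs = pverts G"
    using finite_distinct_list[OF assms] by blast
  then have "distinct (vertex_list G) \<and> set (vertex_list G) = pverts G"
    unfolding vertex_list_def by (rule someI)
  then show "distinct (vertex_list G)" "set (vertex_list G) = pverts G" by auto
qed

text \<open>The spectrum does not depend on the enumeration of the vertices.\<close>

lemma eigenvalue_adjacency_matrix_on:
  assumes vs: "distinct vs" "set vs = pverts G"
  shows "eigenvalue (adjacency_matrix_on vs G) k \<longleftrightarrow>
    (\<exists>f. (\<exists>v\<in>pverts G. f v \<noteq> 0) \<and>
         (\<forall>u\<in>pverts G. (\<Sum>v\<in>pverts G. if (u, v) \<in> parcs G then f v else 0) = k * f u))"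
    (is "_ \<longleftrightarrow> ?R")
proof -
  let ?A = "adjacency_matrix_on vs G" and ?n = "length vs"
  have bij: "bij_betw ((!) vs) {..<?n} (pverts G)"
    using bij_betw_nth[OF vs(1) refl refl] vs(2) by simp
  have nz: "(vec ?n (\<lambda>i. f (vs ! i)) \<noteq> 0\<^sub>v ?n) \<longleftrightarrow> (\<exists>v\<in>pverts G. f v \<noteq> 0)"
    for f :: "'a \<Rightarrow> real"
    unfolding vs(2)[symmetric] using all_set_conv_all_nth[of vs "\<lambda>v. f v = 0"]
    by (auto simp: vec_eq_iff)
  have mv: "(?A *\<^sub>v vec ?n (\<lambda>i. f (vs ! i))) $ i =
      (\<Sum>v\<in>pverts G. if (vs ! i, v) \<in> parcs G then f v else 0)"
    if "i < ?n" for f :: "'a \<Rightarrow> real" and i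
  proof -
    have "(?A *\<^sub>v vec ?n (\<lambda>i. f (vs ! i))) $ i =
        (\<Sum>j<?n. (if (vs ! i, vs ! j) \<in> parcs G then f (vs ! j) else 0))"
      using that
      by (auto simp: adjacency_matrix_on_def scalar_prod_def atLeast0LessThan intro!: sum.cong)
    also have "\<dots> = (\<Sum>v\<in>pverts G. if (vs ! i, v) \<in> parcs G then f v else 0)"
      by (rule sum.reindex_bij_betw[OF bij])
    finally show ?thesis .
  qed
  have key: "eigenvector ?A (vec ?n (\<lambda>i. f (vs ! i))) k \<longleftrightarrow>
      (\<exists>v\<in>pverts G. f v \<noteq> 0) \<and>
      (\<forall>u\<in>pverts G. (\<Sum>v\<in>pverts G. if (u, v) \<in> parcs G then f v else 0) = k * f u)" for f
  proof -
    have dim: "dim_row ?A = ?n" by (simp add: adjacency_matrix_on_def)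
    have "?A *\<^sub>v vec ?n (\<lambda>i. f (vs ! i)) = k \<cdot>\<^sub>v vec ?n (\<lambda>i. f (vs ! i)) \<longleftrightarrow>
        (\<forall>i<?n. (\<Sum>v\<in>pverts G. if (vs ! i, v) \<in> parcs G then f v else 0) = k * f (vs ! i))"
      unfolding vec_eq_iff using mv dim by simp
    also have "\<dots> \<longleftrightarrow>
        (\<forall>u\<in>pverts G. (\<Sum>v\<in>pverts G. if (u, v) \<in> parcs G then f v else 0) = k * f u)"
      unfolding vs(2)[symmetric] by (simp only: all_set_conv_all_nth)
    finally show ?thesis using nz by (simp add: eigenvector_def dim)
  qed
  show ?thesis
  proof
    assume "eigenvalue ?A k"
    then obtain x where x: "eigenvector ?A x k" by (auto simp: eigenvalue_def)
    define f where "f v = x $ (the_inv_into {..<?n} ((!) vs) v)" for v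
    have "f (vs ! i) = x $ i" if "i < ?n" for i
      using that the_inv_into_f_f[OF bij_betw_imp_inj_on[OF bij], of i] by (simp add: f_def)
    moreover have "dim_vec x = ?n" using x by (simp add: eigenvector_def adjacency_matrix_on_def)
    ultimately have "x = vec ?n (\<lambda>i. f (vs ! i))" by (auto simp: vec_eq_iff)
    then show ?R using x key[of f] by blast
  next
    assume ?R
    then show "eigenvalue ?A k" using key by (auto simp: eigenvalue_def)
  qed
qed

end

theory Submission
  imports Defs "HOL-Analysis.Function_Topology" "HOL-Analysis.Convex"
begin

text \<open>
  Put \<open>\<epsilon> = 1 / (80 r\<^sup>3)\<close> and let \<open>W\<close> be a nonempty vertex set maximizing the potential
  \<open>\<mu>(G[W]) / |W| + (\<epsilon> / 32) ln |W|\<close>. If some vertex of \<open>G[W]\<close> had degree at most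
  \<open>(1 - 1/r - \<epsilon>)|W|\<close>, the smallest entry of the Perron vector would be so small that deleting its
  vertex increases the potential; so \<open>G[W]\<close> has large minimum degree. Moreover \<open>|W|\<close> is at least a
  constant times \<open>n\<close>, and either \<open>W\<close> is everything or \<open>\<mu>(G[W]) > (1 - 1/r)|W|\<close>. In both cases
  \<open>G[W]\<close> is not \<open>r\<close>-partite, since an \<open>r\<close>-partite graph has at most the largest eigenvalue of the
  Turan graph of the same order.

  On the other hand, a graph of this minimum degree without \<open>K_r\<^sup>+(s, \<dots>, s)\<close> is \<open>r\<close>-partite.
  Greedy choice and the pigeonhole principle give a complete \<open>r\<close>-partite subgraph with parts
  \<open>A_i\<close> of size \<open>64 r\<^sup>2 s\<close>. No vertex has \<open>s\<close> neighbours in every \<open>A_i\<close>, so by counting almost all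
  vertices miss almost all of one \<open>A_i\<close> and little of the others; these vertices form \<open>r\<close> large
  independent clusters which are almost completely joined to each other. Repeating the argument with
  the clusters in place of the \<open>A_i\<close> puts every vertex into a class, and an edge inside a class
  would again produce \<open>K_r\<^sup>+(s, \<dots>, s)\<close>.
\<close>

section \<open>Complete multipartite subgraphs of dense graphs\<close>

definition mutually_joined :: "'a rel \<Rightarrow> ('i \<Rightarrow> 'a set) \<Rightarrow> 'i set \<Rightarrow> bool" where
  "mutually_joined E A I \<longleftrightarrow> pairwise (\<lambda>i j. A i \<times> A j \<subseteq> E) I"

lemma mutually_joinedI:
  assumes "\<And>i j u v. i \<in> I \<Longrightarrow> j \<in> I \<Longrightarrow> i \<noteq> j \<Longrightarrow> u \<in> A i \<Longrightarrow> v \<in> A j \<Longrightarrow> (u, v) \<in> E"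
  shows "mutually_joined E A I"
  using assms unfolding mutually_joined_def pairwise_def by blast

lemma mutually_joinedD:
  assumes "mutually_joined E A I" "i \<in> I" "j \<in> I" "i \<noteq> j" "u \<in> A i" "v \<in> A j"
  shows "(u, v) \<in> E"
  using assms unfolding mutually_joined_def pairwise_def by blast

lemma mutually_joined_mono:
  assumes "mutually_joined E A I" "\<And>i. i \<in> I \<Longrightarrow> B i \<subseteq> A i"
  shows "mutually_joined E B I"
  using assms unfolding mutually_joined_def pairwise_def by blast

lemma real_card_Diff:
  assumes "finite A"
  shows "real (card (A - S)) = card A - real (card (A \<inter> S))"
  using card_Int_Diff[OF assms, of S] by simp

lemma sum_card_nonneighbours_swap:
  assumes "sym E" "finite A" "finite B"
  shows "(\<Sum>w\<in>B. card (A - E `` {w})) = (\<Sum>a\<in>A. card (B - E `` {a}))"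
proof -
  have nonneighbours_A: "A - E `` {w} = {a \<in> A. (w, a) \<notin> E}" for w by auto
  have nonneighbours_B: "B - E `` {a} = {w \<in> B. (w, a) \<notin> E}" for a
    using \<open>sym E\<close> by (auto dest: symD)
  show ?thesis
    unfolding nonneighbours_A nonneighbours_B using assms by (intro sum_multicount_gen) auto
qed

lemma card_poorly_joined_le:
  fixes \<delta> \<theta> :: real
  assumes "sym E" and fin: "finite A" "finite B" and "A \<noteq> {}"
    and miss: "\<And>a. a \<in> A \<Longrightarrow> card (B - E `` {a}) \<le> \<delta> * card B"
  shows "(1 - \<theta>) * card {w \<in> B. card (A \<inter> E `` {w}) < \<theta> * card A} \<le> \<delta> * card B"
proof -
  let ?P = "{w \<in> B. card (A \<inter> E `` {w}) < \<theta> * card A}"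
  have "card A * ((1 - \<theta>) * card ?P) = (\<Sum>w\<in>?P. (1 - \<theta>) * card A)" by simp
  also have "\<dots> \<le> (\<Sum>w\<in>?P. real (card (A - E `` {w})))"
    by (intro sum_mono) (auto simp: real_card_Diff[OF fin(1)] left_diff_distrib)
  also have "\<dots> \<le> (\<Sum>w\<in>B. real (card (A - E `` {w})))"
    using fin by (intro sum_mono2) auto
  also have "\<dots> = (\<Sum>a\<in>A. real (card (B - E `` {a})))"
    using sum_card_nonneighbours_swap[OF \<open>sym E\<close> fin] by (metis of_nat_sum)
  also have "\<dots> \<le> card A * (\<delta> * card B)"
    using miss by (rule sum_bounded_above)
  finally show ?thesis
    by (rule mult_left_le_imp_le) (use fin \<open>A \<noteq> {}\<close> in \<open>simp add: card_gt_0_iff\<close>)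
qed

lemma card_well_joined_ge:
  fixes \<delta> \<theta> \<gamma> :: real and A :: "'i \<Rightarrow> 'a set"
  assumes "sym E" "finite I" "finite B" "\<theta> < 1"
    and "\<And>i. i \<in> I \<Longrightarrow> finite (A i) \<and> A i \<noteq> {}"
    and "\<And>i a. i \<in> I \<Longrightarrow> a \<in> A i \<Longrightarrow> card (B - E `` {a}) \<le> \<delta> * card B"
    and density: "card I * \<delta> \<le> (1 - \<gamma>) * (1 - \<theta>)"
  shows "\<gamma> * card B \<le> card {w \<in> B. \<forall>i\<in>I. \<theta> * card (A i) \<le> card (A i \<inter> E `` {w})}"
    (is "_ \<le> real (card ?good)")
proof -
  define bad where "bad i = {w \<in> B. card (A i \<inter> E `` {w}) < \<theta> * card (A i)}" for i
  have "?good = B - (\<Union>i\<in>I. bad i)" by (auto simp: bad_def not_less)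
  then have "card B - card (\<Union>i\<in>I. bad i) \<le> card ?good"
    using \<open>finite I\<close> \<open>finite B\<close> by (simp add: diff_card_le_card_Diff bad_def)
  moreover have "card (\<Union>i\<in>I. bad i) \<le> (\<Sum>i\<in>I. card (bad i))"
    using \<open>finite I\<close> by (rule card_UN_le)
  ultimately have card_good: "card B - (\<Sum>i\<in>I. real (card (bad i))) \<le> card ?good"
    unfolding of_nat_sum[symmetric] by linarith
  have "(1 - \<theta>) * (\<Sum>i\<in>I. real (card (bad i))) \<le> card I * (\<delta> * card B)"
    unfolding sum_distrib_left bad_def
    by (intro sum_bounded_above card_poorly_joined_le) (use assms in auto)
  also have "\<dots> \<le> (1 - \<theta>) * ((1 - \<gamma>) * card B)"
    using mult_right_mono[OF density, of "card B"] by (simp add: mult_ac)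
  finally have "(\<Sum>i\<in>I. real (card (bad i))) \<le> (1 - \<gamma>) * card B"
    using \<open>\<theta> < 1\<close> by simp
  with card_good show ?thesis by (simp add: algebra_simps)
qed

lemma ex_common_trace:
  assumes "finite U" "card U \<le> N" "finite B" "4 ^ N \<le> card B"
  shows "\<exists>S\<subseteq>U. 2 ^ N \<le> card {w \<in> B. U \<inter> E `` {w} = S}"
proof -
  obtain S where trace: "S \<subseteq> U"
    "card B \<le> card ((\<lambda>w. U \<inter> E `` {w}) -` {S} \<inter> B) * card (Pow U)"
    using pigeonhole_card[of "\<lambda>w. U \<inter> E `` {w}" B "Pow U"] assms by auto
  have "(\<lambda>w. U \<inter> E `` {w}) -` {S} \<inter> B = {w \<in> B. U \<inter> E `` {w} = S}" by auto
  then have "4 ^ N \<le> card {w \<in> B. U \<inter> E `` {w} = S} * 2 ^ card U"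
    using assms trace(2) by (simp add: card_Pow)
  also have "\<dots> \<le> card {w \<in> B. U \<inter> E `` {w} = S} * 2 ^ N"
    using \<open>card U \<le> N\<close> by simp
  also have "4 ^ N = 2 ^ N * (2 :: nat) ^ N" by (simp flip: power_mult_distrib)
  finally show ?thesis using trace(1) by auto
qed

text \<open>
  A positive fraction of \<open>B\<close> is well joined to every \<open>A i\<close>; by the pigeonhole principle many of
  these vertices have the same trace \<open>S\<close> on the union of the \<open>A i\<close>.
\<close>

lemma ex_completely_joined_traces:
  fixes A :: "'i \<Rightarrow> 'a set" and \<delta> \<gamma> :: real and q T N :: nat
  assumes "sym E" "finite I" "finite B" "q \<ge> 2" "T > 0"
    and card_A: "\<And>i. i \<in> I \<Longrightarrow> card (A i) = q * T"
    and "\<And>i a. i \<in> I \<Longrightarrow> a \<in> A i \<Longrightarrow> card (B - E `` {a}) \<le> \<delta> * card B"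
    and "card I * \<delta> \<le> (1 - \<gamma>) * (1 - 1 / q)"
    and N_bounds: "card I * (q * T) \<le> N" "4 ^ N \<le> \<gamma> * card B"
  shows "\<exists>F S. F \<subseteq> B \<and> 2 ^ N \<le> card F \<and> F \<times> S \<subseteq> E \<and> (\<forall>i\<in>I. T \<le> card (A i \<inter> S))"
proof -
  have finite_A: "finite (A i) \<and> A i \<noteq> {}" if "i \<in> I" for i
    using card_A[OF that] \<open>q \<ge> 2\<close> \<open>T > 0\<close> by (intro conjI card_ge_0_finite) auto
  define good where "good = {w \<in> B. \<forall>i\<in>I. 1 / q * card (A i) \<le> card (A i \<inter> E `` {w})}"
  define U where "U = (\<Union>i\<in>I. A i)"
  have "\<gamma> * card B \<le> card good"
    unfolding good_def using assms finite_A by (intro card_well_joined_ge) auto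
  with N_bounds(2) have "4 ^ N \<le> real (card good)" by linarith
  then have "4 ^ N \<le> card good" by (metis of_nat_le_iff of_nat_numeral of_nat_power)
  moreover have "card U \<le> N"
    using card_UN_le[OF \<open>finite I\<close>, of A] card_A N_bounds(1) by (simp add: U_def)
  moreover have "finite U" "finite good"
    using finite_A assms by (auto simp: U_def good_def)
  ultimately obtain S where same_trace: "2 ^ N \<le> card {w \<in> good. U \<inter> E `` {w} = S}"
    using ex_common_trace[of U N good E] by blast
  define F where "F = {w \<in> good. U \<inter> E `` {w} = S}"
  have "2 ^ N \<le> card F" using same_trace by (simp add: F_def)
  then have "F \<noteq> {}" by auto
  then obtain w where "w \<in> F" by blast
  have "T \<le> card (A i \<inter> S)" if "i \<in> I" for i
  proof -
    have "T \<le> card (A i \<inter> E `` {w})"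
      using \<open>w \<in> F\<close> that card_A[OF that] \<open>q \<ge> 2\<close> by (auto simp: F_def good_def)
    also have "A i \<inter> E `` {w} = A i \<inter> S" using \<open>w \<in> F\<close> that by (auto simp: F_def U_def)
    finally show ?thesis .
  qed
  moreover have "F \<subseteq> B" "F \<times> S \<subseteq> E" by (auto simp: F_def good_def)
  ultimately show ?thesis using \<open>2 ^ N \<le> card F\<close> by blast
qed

lemma extend_mutually_joined:
  fixes A :: "'i \<Rightarrow> 'a set" and \<delta> \<gamma> :: real and q T N :: nat
  assumes "sym E" "finite I" "k \<notin> I" "finite B" "q \<ge> 2" "T > 0"
    and "\<And>i. i \<in> I \<Longrightarrow> card (A i) = q * T"
    and joined: "mutually_joined E A I"
    and "\<And>i a. i \<in> I \<Longrightarrow> a \<in> A i \<Longrightarrow> card (B - E `` {a}) \<le> \<delta> * card B"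
    and "card I * \<delta> \<le> (1 - \<gamma>) * (1 - 1 / q)"
    and "T \<le> N" "card I * (q * T) \<le> N" "4 ^ N \<le> \<gamma> * card B"
  shows "\<exists>A'. (\<forall>i\<in>I. A' i \<subseteq> A i) \<and> A' k \<subseteq> B \<and> (\<forall>i\<in>insert k I. card (A' i) = T) \<and>
    mutually_joined E A' (insert k I)"
proof -
  have "\<exists>F S. F \<subseteq> B \<and> 2 ^ N \<le> card F \<and> F \<times> S \<subseteq> E \<and> (\<forall>i\<in>I. T \<le> card (A i \<inter> S))"
    by (rule ex_completely_joined_traces[where q = q and \<delta> = \<delta> and \<gamma> = \<gamma>]) (fact assms)+
  then obtain F S where "F \<subseteq> B" and card_F: "2 ^ N \<le> card F" and "F \<times> S \<subseteq> E"
    and card_traces: "\<And>i. i \<in> I \<Longrightarrow> T \<le> card (A i \<inter> S)"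
    by blast
  define C where "C i = (if i = k then F else A i \<inter> S)" for i
  have "T \<le> card F" using card_F \<open>T \<le> N\<close> less_exp[of N] by linarith
  then have "T \<le> card (C i)" if "i \<in> insert k I" for i
    using card_traces that by (auto simp: C_def)
  then have "\<exists>C'. C' \<subseteq> C i \<and> card C' = T" if "i \<in> insert k I" for i
    using that by (meson obtain_subset_with_card_n)
  then obtain A' where A'_subset: "\<And>i. i \<in> insert k I \<Longrightarrow> A' i \<subseteq> C i"
    and A'_card: "\<And>i. i \<in> insert k I \<Longrightarrow> card (A' i) = T"
    by metis
  have FS_edges: "(a, w) \<in> E" "(w, a) \<in> E" if "a \<in> S" "w \<in> F" for a w
    using that \<open>F \<times> S \<subseteq> E\<close> symD[OF \<open>sym E\<close>] by blast+
  have "mutually_joined E C (insert k I)"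
    using FS_edges mutually_joinedD[OF joined]
    by (intro mutually_joinedI) (auto simp: C_def split: if_splits)
  then have "mutually_joined E A' (insert k I)" by (rule mutually_joined_mono) (rule A'_subset)
  moreover have "A' k \<subseteq> B" using A'_subset[of k] \<open>F \<subseteq> B\<close> by (auto simp: C_def)
  moreover have "A' i \<subseteq> A i" if "i \<in> I" for i
    using A'_subset[of i] that \<open>k \<notin> I\<close> by (auto simp: C_def split: if_splits)
  ultimately show ?thesis using A'_card by blast
qed

lemma ex_mutually_joined_subfamily:
  fixes X :: "'i \<Rightarrow> 'a set" and \<delta> \<gamma> :: real and q s :: nat
  assumes "sym E" "finite I" "q \<ge> 2" "s > 0" "0 \<le> \<delta>"
    and "\<And>i j v. i \<in> I \<Longrightarrow> j \<in> I \<Longrightarrow> i \<noteq> j \<Longrightarrow> v \<in> X i \<Longrightarrow>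
      card (X j - E `` {v}) \<le> \<delta> * card (X j)"
    and "(real (card I) - 1) * \<delta> \<le> (1 - \<gamma>) * (1 - 1 / q)"
    and "\<And>i. i \<in> I \<Longrightarrow> 4 ^ (s * q ^ card I) \<le> \<gamma> * card (X i)"
  shows "\<exists>A. (\<forall>i\<in>I. A i \<subseteq> X i \<and> card (A i) = s) \<and> mutually_joined E A I"
  using assms(2,4,6-)
proof (induction I arbitrary: s rule: finite_induct)
  case empty
  then show ?case by (auto simp: mutually_joined_def)
next
  case (insert k I)
  have size: "q * s * q ^ card I = s * q ^ card (insert k I)" using insert.hyps by simp
  have density: "card I * \<delta> \<le> (1 - \<gamma>) * (1 - 1 / q)" using insert.prems(3) insert.hyps by simp
  have "\<exists>A. (\<forall>i\<in>I. A i \<subseteq> X i \<and> card (A i) = q * s) \<and> mutually_joined E A I"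
  proof (rule insert.IH)
    show "4 ^ (q * s * q ^ card I) \<le> \<gamma> * card (X i)" if "i \<in> I" for i
      using insert.prems(4)[of i] that unfolding size by simp
    show "(real (card I) - 1) * \<delta> \<le> (1 - \<gamma>) * (1 - 1 / q)"
      using density \<open>0 \<le> \<delta>\<close> by (simp add: left_diff_distrib)
    show "card (X j - E `` {v}) \<le> \<delta> * card (X j)" if "i \<in> I" "j \<in> I" "i \<noteq> j" "v \<in> X i" for i j v
      using insert.prems(2) that by blast
  qed (use insert.prems(1) \<open>q \<ge> 2\<close> in auto)
  then obtain A where A_subset: "\<And>i. i \<in> I \<Longrightarrow> A i \<subseteq> X i"
    and A_card: "\<And>i. i \<in> I \<Longrightarrow> card (A i) = q * s" and A_joined: "mutually_joined E A I"
    by blast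
  have "\<exists>A'. (\<forall>i\<in>I. A' i \<subseteq> A i) \<and> A' k \<subseteq> X k \<and> (\<forall>i\<in>insert k I. card (A' i) = s) \<and>
    mutually_joined E A' (insert k I)"
  proof (rule extend_mutually_joined[where N = "s * q ^ card (insert k I)"])
    show "card (X k - E `` {a}) \<le> \<delta> * card (X k)" if "i \<in> I" "a \<in> A i" for i a
      using insert.prems(2)[of i k a] insert.hyps A_subset[of i] that by auto
    have "card I \<le> q ^ card I" using power_gt_expt[of q "card I"] \<open>q \<ge> 2\<close> by simp
    then show "card I * (q * s) \<le> s * q ^ card (insert k I)"
      unfolding size[symmetric] by (simp add: mult_ac)
    show "4 ^ (s * q ^ card (insert k I)) \<le> \<gamma> * card (X k)" by (rule insert.prems(4)) simp
    then have "0 < \<gamma> * card (X k)" by (rule less_le_trans[rotated]) simp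
    then show "finite (X k)" by (cases "finite (X k)") simp_all
    show "s \<le> s * q ^ card (insert k I)" using \<open>q \<ge> 2\<close> by simp
  qed (use insert.hyps insert.prems(1) A_card A_joined density assms(1,3) in auto)
  then obtain A' where A'_subset: "\<And>i. i \<in> I \<Longrightarrow> A' i \<subseteq> A i" "A' k \<subseteq> X k"
    and "\<And>i. i \<in> insert k I \<Longrightarrow> card (A' i) = s" "mutually_joined E A' (insert k I)"
    by blast
  moreover have "A' i \<subseteq> X i" if "i \<in> insert k I" for i
    using that A'_subset(1)[of i] A'_subset(2) A_subset[of i] by auto
  ultimately show ?case by blast
qed

corollary ex_mutually_joined_parts:
  fixes X :: "nat \<Rightarrow> 'a set" and r s :: nat
  assumes "sym E" "r > 0" "s > 0"
    and "\<And>i j v. i < r \<Longrightarrow> j < r \<Longrightarrow> i \<noteq> j \<Longrightarrow> v \<in> X i \<Longrightarrow>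
      card (X j - E `` {v}) \<le> (1 / r + 1 / (4 * r\<^sup>2)) * card (X j)"
    and size: "\<And>i. i < r \<Longrightarrow> 4 * r * 4 ^ (s * (2 * r) ^ r) \<le> card (X i)"
  shows "\<exists>A. (\<forall>i<r. A i \<subseteq> X i \<and> card (A i) = s) \<and> mutually_joined E A {..<r}"
proof -
  have "\<exists>A. (\<forall>i\<in>{..<r}. A i \<subseteq> X i \<and> card (A i) = s) \<and> mutually_joined E A {..<r}"
  proof (rule ex_mutually_joined_subfamily[where q = "2 * r" and \<gamma> = "1 / (4 * r)"])
    show "4 ^ (s * (2 * r) ^ card {..<r}) \<le> 1 / (4 * r) * card (X i)" if "i \<in> {..<r}" for i
    proof -
      have "real (4 * r * 4 ^ (s * (2 * r) ^ r)) \<le> card (X i)"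
        using size[of i] that by (simp only: of_nat_le_iff lessThan_iff)
      then show ?thesis using \<open>r > 0\<close> by (simp add: field_simps)
    qed
    show "(real (card {..<r}) - 1) * (1 / r + 1 / (4 * r\<^sup>2)) \<le>
      (1 - 1 / (4 * r)) * (1 - 1 / (2 * r))"
      using \<open>r > 0\<close> by (simp add: field_simps power2_eq_square)
  qed (use assms in auto)
  then show ?thesis by (simp add: Ball_def)
qed

section \<open>Dense graphs without the multipartite graph with an extra edge\<close>

definition contains_multipartite_plus :: "'a rel \<Rightarrow> nat \<Rightarrow> nat \<Rightarrow> bool" where
  "contains_multipartite_plus E r s \<longleftrightarrow> (\<exists>P. mutually_joined E P {..<r} \<and> (\<forall>i<r. s \<le> card (P i)) \<and>
     (\<exists>i<r. \<exists>u\<in>P i. \<exists>w\<in>P i. (u, w) \<in> E))"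

lemma contains_multipartite_plus_edgeI:
  assumes "sym E" and joined: "mutually_joined E A {..<r}" and "\<And>j. j < r \<Longrightarrow> s \<le> card (A j)"
    and "i < r" "(u, w) \<in> E"
    and common: "\<And>j. j < r \<Longrightarrow> j \<noteq> i \<Longrightarrow> A j \<subseteq> E `` {u} \<inter> E `` {w}"
  shows "contains_multipartite_plus E r s"
proof -
  define P where "P = A(i := insert u (insert w (A i)))"
  have joined_i: "(x, y) \<in> E" if "j < r" "j \<noteq> i" "x \<in> P i" "y \<in> A j" for j x y
    using that \<open>i < r\<close> common[of j] mutually_joinedD[OF joined, of i j x y] by (auto simp: P_def)
  have "mutually_joined E P {..<r}"
  proof (rule mutually_joinedI)
    fix j k x y assume indices: "j \<in> {..<r}" "k \<in> {..<r}" "j \<noteq> k" and members: "x \<in> P j" "y \<in> P k"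
    consider (left) "j = i" | (right) "k = i" | (neither) "j \<noteq> i" "k \<noteq> i" by blast
    then show "(x, y) \<in> E"
    proof cases
      case left
      then show ?thesis using joined_i[of k x y] indices members by (simp add: P_def)
    next
      case right
      then have "(y, x) \<in> E" using joined_i[of j y x] indices members by (simp add: P_def)
      then show ?thesis by (rule symD[OF \<open>sym E\<close>])
    next
      case neither
      then show ?thesis using mutually_joinedD[OF joined indices] members by (simp add: P_def)
    qed
  qed
  moreover have "s \<le> card (P j)" if "j < r" for j
    using assms(3)[OF that] card_insert_le[of "A i" w] card_insert_le[of "insert w (A i)" u]
    by (auto simp: P_def)
  moreover have "u \<in> P i" "w \<in> P i" by (auto simp: P_def)
  ultimately show ?thesis
    using \<open>i < r\<close> \<open>(u, w) \<in> E\<close> unfolding contains_multipartite_plus_def by blast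
qed

lemma contains_multipartite_plus_vertexI:
  assumes "sym E" and joined: "mutually_joined E A {..<r}" and card: "\<And>j. j < r \<Longrightarrow> s \<le> card (A j)"
    and "0 < r" "0 < s" and nbrs: "\<And>j. j < r \<Longrightarrow> A j \<subseteq> E `` {w}"
  shows "contains_multipartite_plus E r s"
proof -
  obtain b where "b \<in> A 0" using card[of 0] \<open>0 < r\<close> \<open>0 < s\<close> by fastforce
  show ?thesis
  proof (rule contains_multipartite_plus_edgeI[OF \<open>sym E\<close> joined card \<open>0 < r\<close>])
    show "(w, b) \<in> E" using nbrs[OF \<open>0 < r\<close>] \<open>b \<in> A 0\<close> by auto
    show "A j \<subseteq> E `` {w} \<inter> E `` {b}" if "j < r" "j \<noteq> 0" for j
      using nbrs[OF that(1)] mutually_joinedD[OF joined, of 0 j b] that \<open>0 < r\<close> \<open>b \<in> A 0\<close> by auto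
  qed
qed

definition multipartite_rich :: "'a rel \<Rightarrow> nat \<Rightarrow> nat \<Rightarrow> real \<Rightarrow> (nat \<Rightarrow> 'a set) \<Rightarrow> bool" where
  "multipartite_rich E r s l Y \<longleftrightarrow> (\<forall>Z. (\<forall>i<r. Z i \<subseteq> Y i \<and> l \<le> card (Z i)) \<longrightarrow>
     (\<exists>A. (\<forall>i<r. A i \<subseteq> Z i \<and> card (A i) = s) \<and> mutually_joined E A {..<r}))"

lemma multipartite_richD:
  assumes "multipartite_rich E r s l Y" "\<And>i. i < r \<Longrightarrow> Z i \<subseteq> Y i" "\<And>i. i < r \<Longrightarrow> l \<le> card (Z i)"
  shows "\<exists>A. (\<forall>i<r. A i \<subseteq> Z i \<and> card (A i) = s) \<and> mutually_joined E A {..<r}"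
  using assms unfolding multipartite_rich_def by simp

lemma multipartite_rich_if_mutually_joined:
  assumes "mutually_joined E A {..<r}"
  shows "multipartite_rich E r s s A"
  unfolding multipartite_rich_def
proof (intro allI impI)
  fix Z assume Z_parts: "\<forall>i<r. Z i \<subseteq> A i \<and> real s \<le> card (Z i)"
  then have "\<exists>B. B \<subseteq> Z i \<and> card B = s" if "i < r" for i
    using that by (metis obtain_subset_with_card_n of_nat_le_iff)
  then obtain B where B_parts: "\<And>i. i < r \<Longrightarrow> B i \<subseteq> Z i \<and> card (B i) = s" by metis
  moreover have "mutually_joined E B {..<r}"
    using assms by (rule mutually_joined_mono) (use B_parts Z_parts in blast)
  ultimately show "\<exists>B. (\<forall>i<r. B i \<subseteq> Z i \<and> card (B i) = s) \<and> mutually_joined E B {..<r}" by blast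
qed

lemma ex_poorly_joined_part:
  fixes l :: real
  assumes "sym E" "multipartite_rich E r s l Y" "\<not> contains_multipartite_plus E r s" "0 < r" "0 < s"
  shows "\<exists>i<r. card (Y i \<inter> E `` {w}) < l"
proof (rule ccontr)
  assume "\<not> ?thesis"
  then have "l \<le> card (Y i \<inter> E `` {w})" if "i < r" for i
    using that by (meson not_less)
  then obtain A where "\<forall>i<r. A i \<subseteq> Y i \<inter> E `` {w} \<and> card (A i) = s" "mutually_joined E A {..<r}"
    using multipartite_richD[OF assms(2), of "\<lambda>i. Y i \<inter> E `` {w}"] by auto
  then have "contains_multipartite_plus E r s"
    using assms by (intro contains_multipartite_plus_vertexI[of E A r s w]) auto
  then show False using assms(3) by simp
qed

lemma card_le_Diff_Diff_Int: "card Y \<le> card (Y - S) + card (Y - T) + card (Y \<inter> S \<inter> T)"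
proof (cases "finite Y")
  case True
  then have "card Y \<le> card ((Y - S) \<union> (Y - T) \<union> (Y \<inter> S \<inter> T))" by (intro card_mono) auto
  also have "\<dots> \<le> card (Y - S) + card (Y - T) + card (Y \<inter> S \<inter> T)"
    by (meson add_mono card_Un_le le_trans order_refl)
  finally show ?thesis .
qed simp

lemma nonadjacent_if_few_nonneighbours:
  fixes l :: real
  assumes "sym E" "multipartite_rich E r s l Y" "\<not> contains_multipartite_plus E r s"
    and "i < r" "l \<le> card (Y i)"
    and few: "\<And>j. j < r \<Longrightarrow> j \<noteq> i \<Longrightarrow>
      l + card (Y j - E `` {u}) + card (Y j - E `` {w}) \<le> card (Y j)"
  shows "(u, w) \<notin> E"
proof
  assume "(u, w) \<in> E"
  define Z where "Z j = (if j = i then Y i else Y j \<inter> E `` {u} \<inter> E `` {w})" for j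
  have "l \<le> card (Z j)" if "j < r" for j
  proof (cases "j = i")
    case False
    have "real (card (Y j)) \<le>
        card (Y j - E `` {u}) + card (Y j - E `` {w}) + card (Y j \<inter> E `` {u} \<inter> E `` {w})"
      unfolding of_nat_le_iff by (rule card_le_Diff_Diff_Int)
    then show ?thesis using few[OF that False] False by (simp add: Z_def)
  qed (simp add: Z_def assms)
  moreover have "Z j \<subseteq> Y j" for j by (auto simp: Z_def)
  ultimately obtain A where A_parts: "\<forall>j<r. A j \<subseteq> Z j \<and> card (A j) = s"
    and A_joined: "mutually_joined E A {..<r}"
    using multipartite_richD[OF assms(2), of Z] by blast
  have "contains_multipartite_plus E r s"
  proof (rule contains_multipartite_plus_edgeI[OF \<open>sym E\<close> A_joined _ \<open>i < r\<close> \<open>(u, w) \<in> E\<close>])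
    show "A j \<subseteq> E `` {u} \<inter> E `` {w}" if "j < r" "j \<noteq> i" for j
      using A_parts that by (fastforce simp: Z_def)
  qed (simp add: A_parts)
  then show False using assms(3) by simp
qed

locale multipartite_seed =
  fixes E :: "'a rel" and V :: "'a set" and r s t q :: nat and A :: "nat \<Rightarrow> 'a set"
  assumes sym: "sym E" and finite_vertices: "finite V" and r_pos: "0 < r" and s_pos: "0 < s"
    and part_subset: "i < r \<Longrightarrow> A i \<subseteq> V" and card_part: "i < r \<Longrightarrow> card (A i) = t"
    and joined: "mutually_joined E A {..<r}"
    and plus_free: "\<not> contains_multipartite_plus E r s"
    and part_size: "2 * q + s \<le> t"
begin

lemma multipartite_rich_parts: "multipartite_rich E r s s A"
  using joined by (rule multipartite_rich_if_mutually_joined)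

lemma finite_part: "i < r \<Longrightarrow> finite (A i)"
  using part_subset finite_vertices finite_subset by blast

lemma card_nonneighbours_part: "i < r \<Longrightarrow> card (A i - E `` {w}) + card (A i \<inter> E `` {w}) = t"
  using card_Int_Diff[OF finite_part, of i "E `` {w}"] card_part by simp

lemma ex_part_few_neighbours: "\<exists>i<r. card (A i \<inter> E `` {w}) < s"
  using ex_poorly_joined_part[OF sym multipartite_rich_parts plus_free r_pos s_pos] by simp

definition cluster :: "nat \<Rightarrow> 'a set" where
  "cluster i = {w \<in> V. card (A i \<inter> E `` {w}) < s \<and> (\<forall>j<r. j \<noteq> i \<longrightarrow> card (A j - E `` {w}) \<le> q)}"

lemma cluster_subset: "cluster i \<subseteq> V"
  by (auto simp: cluster_def)

lemma cluster_independent: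
  assumes "i < r" "u \<in> cluster i" "w \<in> cluster i"
  shows "(u, w) \<notin> E"
proof (rule nonadjacent_if_few_nonneighbours[OF sym multipartite_rich_parts plus_free \<open>i < r\<close>])
  show "real s \<le> card (A i)" using part_size card_part[OF \<open>i < r\<close>] by simp
  show "real s + card (A j - E `` {u}) + card (A j - E `` {w}) \<le> card (A j)"
    if "j < r" "j \<noteq> i" for j
  proof -
    have "card (A j - E `` {u}) \<le> q" "card (A j - E `` {w}) \<le> q"
      using assms that by (auto simp: cluster_def)
    then show ?thesis using part_size card_part[OF \<open>j < r\<close>] by simp
  qed
qed

lemma cluster_disjoint:
  assumes "i < r" "i \<noteq> j"
  shows "cluster i \<inter> cluster j = {}"
proof -
  have False if "w \<in> cluster i" "w \<in> cluster j" for w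
  proof -
    have "card (A i \<inter> E `` {w}) < s" "card (A i - E `` {w}) \<le> q"
      using that assms by (auto simp: cluster_def)
    then show False using card_nonneighbours_part[OF \<open>i < r\<close>, of w] part_size by linarith
  qed
  then show ?thesis by blast
qed

definition missed :: "'a \<Rightarrow> nat" where
  "missed w = (\<Sum>i<r. card (A i - E `` {w}))"

lemma missed_ge: "t \<le> missed w + s"
proof -
  obtain i where few: "i < r" "card (A i \<inter> E `` {w}) < s" using ex_part_few_neighbours by blast
  have "card (A i - E `` {w}) \<le> missed w"
    unfolding missed_def using few(1) by (intro member_le_sum) auto
  then show ?thesis using card_nonneighbours_part[OF few(1), of w] few(2) by linarith
qed

lemma missed_ge_outside_clusters:
  assumes "w \<in> V - (\<Union>i<r. cluster i)"
  shows "t + q \<le> missed w + s"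
proof -
  obtain i where few: "i < r" "card (A i \<inter> E `` {w}) < s" using ex_part_few_neighbours by blast
  then obtain j where many: "j < r" "j \<noteq> i" "q < card (A j - E `` {w})"
    using assms by (auto simp: cluster_def not_le)
  have "card (A i - E `` {w}) + card (A j - E `` {w}) = (\<Sum>k\<in>{i, j}. card (A k - E `` {w}))"
    using many by simp
  also have "\<dots> \<le> missed w" unfolding missed_def using few many by (intro sum_mono2) auto
  finally show ?thesis using card_nonneighbours_part[OF few(1), of w] few(2) many(3) by linarith
qed

lemma sum_missed_le:
  fixes \<delta> :: real
  assumes miss: "\<And>v. v \<in> V \<Longrightarrow> card (V - E `` {v}) \<le> \<delta> * card V"
  shows "(\<Sum>w\<in>V. real (missed w)) \<le> r * t * \<delta> * card V"
proof -
  have "(\<Sum>w\<in>V. missed w) = (\<Sum>i<r. \<Sum>w\<in>V. card (A i - E `` {w}))"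
    unfolding missed_def by (rule sum.swap)
  also have "\<dots> = (\<Sum>i<r. \<Sum>a\<in>A i. card (V - E `` {a}))"
    using sym finite_part finite_vertices by (simp add: sum_card_nonneighbours_swap)
  finally have "(\<Sum>w\<in>V. real (missed w)) = (\<Sum>i<r. \<Sum>a\<in>A i. real (card (V - E `` {a})))"
    by (simp flip: of_nat_sum)
  also have "\<dots> \<le> (\<Sum>i<r. t * (\<delta> * card V))"
  proof (rule sum_mono)
    fix i assume "i \<in> {..<r}"
    then show "(\<Sum>a\<in>A i. real (card (V - E `` {a}))) \<le> t * (\<delta> * card V)"
      using sum_bounded_above[of "A i" "\<lambda>a. real (card (V - E `` {a}))"] miss
        part_subset[of i] card_part[of i] by (metis lessThan_iff subsetD)
  qed
  finally show ?thesis by (simp add: mult_ac)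
qed

lemma card_outside_clusters_le:
  fixes \<delta> :: real
  assumes miss: "\<And>v. v \<in> V \<Longrightarrow> card (V - E `` {v}) \<le> \<delta> * card V"
  shows "real q * card (V - (\<Union>i<r. cluster i)) \<le> (t * (r * \<delta> - 1) + s) * card V"
proof -
  define X where "X = V - (\<Union>i<r. cluster i)"
  have "X \<subseteq> V" by (auto simp: X_def)
  have "(real t - s) * card V + real q * card X =
      (\<Sum>w\<in>V. (real t - s) + (if w \<in> X then real q else 0))"
    using finite_vertices \<open>X \<subseteq> V\<close> by (simp add: sum.distrib sum.If_cases Int_absorb1)
  also have "\<dots> \<le> (\<Sum>w\<in>V. real (missed w))"
  proof (rule sum_mono)
    fix w
    have "t + (if w \<in> X then q else 0) \<le> missed w + s"
      using missed_ge[of w] missed_ge_outside_clusters[of w] unfolding X_def by auto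
    then have "real (t + (if w \<in> X then q else 0)) \<le> real (missed w + s)"
      by (simp only: of_nat_le_iff)
    then show "real t - s + (if w \<in> X then real q else 0) \<le> real (missed w)"
      by (simp split: if_splits)
  qed
  also have "\<dots> \<le> r * t * \<delta> * card V" using miss by (rule sum_missed_le)
  finally show ?thesis by (simp add: X_def algebra_simps)
qed

end

locale independent_clusters =
  fixes E :: "'a rel" and V :: "'a set" and r :: nat and W :: "nat \<Rightarrow> 'a set" and a z :: real
  assumes sym: "sym E" and finite_vertices: "finite V" and a_nonneg: "0 \<le> a"
    and cluster_subset: "i < r \<Longrightarrow> W i \<subseteq> V"
    and independent: "i < r \<Longrightarrow> u \<in> W i \<Longrightarrow> w \<in> W i \<Longrightarrow> (u, w) \<notin> E"
    and disjoint: "i < r \<Longrightarrow> j < r \<Longrightarrow> i \<noteq> j \<Longrightarrow> W i \<inter> W j = {}"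
    and card_nonneighbours: "v \<in> V \<Longrightarrow> card (V - E `` {v}) \<le> a"
    and card_outside: "card (V - (\<Union>i<r. W i)) + r * a \<le> card V + z"
begin

lemma finite_cluster: "i < r \<Longrightarrow> finite (W i)"
  using cluster_subset finite_vertices finite_subset by blast

lemma card_cluster_le:
  assumes "i < r"
  shows "card (W i) \<le> a"
proof (cases "W i = {}")
  case False
  then obtain v where "v \<in> W i" by auto
  have "card (W i) \<le> card (V - E `` {v})"
    using cluster_subset[OF assms] independent[OF assms \<open>v \<in> W i\<close>] finite_vertices
    by (intro card_mono) auto
  also have "\<dots> \<le> a" using card_nonneighbours[of v] cluster_subset[OF assms] \<open>v \<in> W i\<close> by auto
  finally show ?thesis by simp
qed (simp add: a_nonneg)

lemma card_cluster_ge: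
  assumes "i < r"
  shows "a - z \<le> card (W i)"
proof -
  have "card V \<le> card (V - (\<Union>j<r. W j)) + card (\<Union>j<r. W j)"
    using card_Un_le[of "V - (\<Union>j<r. W j)" "\<Union>j<r. W j"] cluster_subset
    by (simp add: Un_absorb2 UN_subset_iff)
  moreover have "card (\<Union>j<r. W j) \<le> (\<Sum>j<r. card (W j))" by (rule card_UN_le) simp
  ultimately have "card V \<le> card (V - (\<Union>j<r. W j)) + (\<Sum>j<r. real (card (W j)))"
    unfolding of_nat_sum[symmetric] of_nat_add[symmetric] of_nat_le_iff by linarith
  also have "(\<Sum>j<r. real (card (W j))) = card (W i) + (\<Sum>j\<in>{..<r} - {i}. real (card (W j)))"
    using assms by (simp add: sum.remove)
  also have "(\<Sum>j\<in>{..<r} - {i}. real (card (W j))) \<le> (real r - 1) * a"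
    using sum_bounded_above[of "{..<r} - {i}" "\<lambda>j. real (card (W j))" a] card_cluster_le assms
    by (simp add: of_nat_diff)
  finally show ?thesis using card_outside by (simp add: left_diff_distrib)
qed

lemma card_nonneighbours_two_clusters:
  assumes "i < r" "j < r" "i \<noteq> j" "v \<in> V"
  shows "card (W i - E `` {v}) + card (W j - E `` {v}) \<le> a"
proof -
  have "card (W i - E `` {v}) + card (W j - E `` {v}) = card ((W i - E `` {v}) \<union> (W j - E `` {v}))"
    using disjoint[OF assms(1-3)] finite_cluster assms
    by (intro card_Un_disjoint[symmetric]) auto
  also have "\<dots> \<le> card (V - E `` {v})"
    using cluster_subset assms finite_vertices by (intro card_mono) auto
  also have "\<dots> \<le> a" using \<open>v \<in> V\<close> by (rule card_nonneighbours)
  finally show ?thesis by simp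
qed

lemma card_nonneighbours_other_cluster:
  assumes "i < r" "j < r" "i \<noteq> j" "v \<in> W i"
  shows "card (W j - E `` {v}) \<le> z"
proof -
  have "W i - E `` {v} = W i" using independent[OF \<open>i < r\<close> \<open>v \<in> W i\<close>] by auto
  moreover have "card (W i - E `` {v}) + card (W j - E `` {v}) \<le> a"
    using assms cluster_subset by (intro card_nonneighbours_two_clusters) auto
  ultimately show ?thesis using card_cluster_ge[OF \<open>i < r\<close>] by simp
qed

lemma multipartite_rich_clusters:
  fixes l :: real and s :: nat
  assumes "0 < s" "z \<le> l / r" and size: "4 * r * 4 ^ (s * (2 * r) ^ r) \<le> l"
  shows "multipartite_rich E r s l W"
  unfolding multipartite_rich_def
proof (intro allI impI)
  fix Z assume "\<forall>i<r. Z i \<subseteq> W i \<and> l \<le> card (Z i)"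
  then have Z_parts: "\<And>i. i < r \<Longrightarrow> Z i \<subseteq> W i" "\<And>i. i < r \<Longrightarrow> l \<le> card (Z i)" by blast+
  show "\<exists>A. (\<forall>i<r. A i \<subseteq> Z i \<and> card (A i) = s) \<and> mutually_joined E A {..<r}"
  proof (cases "r = 0")
    case False
    show ?thesis
    proof (rule ex_mutually_joined_parts[OF sym])
      fix i assume "i < r"
      have "real (4 * r * 4 ^ (s * (2 * r) ^ r)) \<le> card (Z i)"
        using size Z_parts(2)[OF \<open>i < r\<close>] by linarith
      then show "4 * r * 4 ^ (s * (2 * r) ^ r) \<le> card (Z i)" by (simp only: of_nat_le_iff)
    next
      fix i j v assume members: "i < r" "j < r" "i \<noteq> j" "v \<in> Z i"
      have "card (Z j - E `` {v}) \<le> card (W j - E `` {v})"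
        using Z_parts(1)[OF \<open>j < r\<close>] finite_cluster[OF \<open>j < r\<close>] by (intro card_mono) auto
      also have "\<dots> \<le> z"
        using card_nonneighbours_other_cluster members Z_parts(1)[OF \<open>i < r\<close>] by blast
      also have "\<dots> \<le> l / r" by fact
      also have "\<dots> \<le> 1 / r * card (Z j)"
        using Z_parts(2)[OF \<open>j < r\<close>] by (simp add: divide_right_mono)
      also have "\<dots> \<le> (1 / r + 1 / (4 * r\<^sup>2)) * card (Z j)" by (intro mult_right_mono) auto
      finally show "card (Z j - E `` {v}) \<le> (1 / r + 1 / (4 * r\<^sup>2)) * card (Z j)" by simp
    qed (use False \<open>0 < s\<close> in auto)
  qed (simp add: mutually_joined_def)
qed

end

definition proper_coloring :: "'a set \<Rightarrow> 'a rel \<Rightarrow> ('a \<Rightarrow> 'c) \<Rightarrow> bool" where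
  "proper_coloring V E p \<longleftrightarrow> (\<forall>u\<in>V. \<forall>v\<in>V. (u, v) \<in> E \<longrightarrow> p u \<noteq> p v)"

lemma (in independent_clusters) ex_proper_coloring:
  fixes l :: real and s :: nat
  assumes rich: "multipartite_rich E r s l W" and free: "\<not> contains_multipartite_plus E r s"
    and "0 < r" "0 < s" "0 \<le> l" "0 \<le> z" "3 * (z + l) \<le> a"
  shows "\<exists>p \<in> V \<rightarrow> {..<r}. proper_coloring V E p"
proof -
  have "\<forall>v. \<exists>i<r. card (W i \<inter> E `` {v}) < l"
    using ex_poorly_joined_part[OF sym rich free] assms by blast
  then obtain p where p_less: "\<And>v. p v < r" and p_few: "\<And>v. card (W (p v) \<inter> E `` {v}) < l" by metis
  have few: "card (W j - E `` {v}) \<le> z + l" if "v \<in> V" "j < r" "j \<noteq> p v" for j v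
    using card_nonneighbours_two_clusters[of "p v" j v] card_cluster_ge[of "p v"] that
      p_less[of v] p_few[of v]
      real_card_Diff[OF finite_cluster, of "p v" "E `` {v}"] by simp
  have "(u, v) \<notin> E" if same_color: "u \<in> V" "v \<in> V" "p u = p v" for u v
  proof (rule nonadjacent_if_few_nonneighbours[OF sym rich free p_less[of u]])
    show "l \<le> card (W (p u))" using card_cluster_ge[OF p_less[of u]] assms by simp
    show "l + card (W j - E `` {u}) + card (W j - E `` {v}) \<le> card (W j)" if "j < r" "j \<noteq> p u" for j
      using few[OF same_color(1) that] few[of v j] card_cluster_ge[OF that(1)] same_color
        that assms by simp
  qed
  then have "proper_coloring V E p" by (auto simp: proper_coloring_def)
  then show ?thesis using p_less by auto
qed

lemma ex_independent_clusters:
  fixes E :: "'a rel" and V :: "'a set" and r s :: nat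
  assumes "sym E" "finite V" "r \<ge> 2" "s > 0"
    and miss: "\<And>v. v \<in> V \<Longrightarrow> card (V - E `` {v}) \<le> (1 / r + 1 / (80 * r ^ 3)) * card V"
    and "4 * r * 4 ^ (64 * r\<^sup>2 * s * (2 * r) ^ r) \<le> card V"
    and "\<not> contains_multipartite_plus E r s"
  shows "\<exists>W. independent_clusters E V r W
    ((1 / r + 1 / (80 * r ^ 3)) * card V) (card V / (8 * r\<^sup>2))"
proof -
  define R where "R = real r"
  define \<delta> where "\<delta> = 1 / R + 1 / (80 * R ^ 3)"
  have "R \<ge> 2" using \<open>r \<ge> 2\<close> by (simp add: R_def)
  have "\<delta> \<le> 1 / R + 1 / (4 * R\<^sup>2)"
    using \<open>R \<ge> 2\<close> by (simp add: \<delta>_def field_simps power2_eq_square power3_eq_cube)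
  then have "\<delta> * card V \<le> (1 / R + 1 / (4 * R\<^sup>2)) * card V" by (intro mult_right_mono) auto
  then have "card (V - E `` {v}) \<le> (1 / r + 1 / (4 * r\<^sup>2)) * card V" if "v \<in> V" for v
    using order_trans[OF miss[OF that]] by (simp add: \<delta>_def R_def)
  then have "\<exists>A. (\<forall>i<r. A i \<subseteq> V \<and> card (A i) = 64 * r\<^sup>2 * s) \<and> mutually_joined E A {..<r}"
    using assms by (intro ex_mutually_joined_parts) auto
  then obtain A where A_parts: "\<And>i. i < r \<Longrightarrow> A i \<subseteq> V" "\<And>i. i < r \<Longrightarrow> card (A i) = 64 * r\<^sup>2 * s"
    "mutually_joined E A {..<r}"
    by blast
  have "s \<le> r\<^sup>2 * s" using \<open>r \<ge> 2\<close> by simp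
  then interpret multipartite_seed E V r s "64 * r\<^sup>2 * s" "16 * r\<^sup>2 * s" A
    using assms A_parts by unfold_locales auto
  let ?X = "V - (\<Union>i<r. cluster i)"
  have "real (16 * r\<^sup>2 * s) * card ?X \<le> (real (64 * r\<^sup>2 * s) * (r * \<delta> - 1) + s) * card V"
    using miss by (intro card_outside_clusters_le) (auto simp: \<delta>_def R_def)
  also have "real (64 * r\<^sup>2 * s) * (r * \<delta> - 1) + s = 9 / 5 * s"
    using \<open>R \<ge> 2\<close> by (simp add: \<delta>_def field_simps power2_eq_square power3_eq_cube flip: R_def)
  finally have "s * (80 * R\<^sup>2 * card ?X) \<le> s * (9 * card V)" by (simp add: R_def mult_ac)
  then have "80 * R\<^sup>2 * card ?X \<le> 9 * card V" using \<open>s > 0\<close> by simp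
  then have "card ?X + R * (\<delta> * card V) \<le> card V + card V / (8 * R\<^sup>2)"
    using \<open>R \<ge> 2\<close> by (simp add: \<delta>_def field_simps power2_eq_square power3_eq_cube)
  then have "independent_clusters E V r cluster (\<delta> * card V) (card V / (8 * R\<^sup>2))"
    using assms \<open>R \<ge> 2\<close> miss cluster_subset cluster_independent cluster_disjoint
    by unfold_locales (auto simp: \<delta>_def R_def)
  then show ?thesis by (auto simp: \<delta>_def R_def)
qed

theorem ex_proper_coloring_if_plus_free:
  fixes E :: "'a rel" and V :: "'a set" and r s :: nat
  assumes "sym E" "finite V" "r \<ge> 2" "s > 0"
    and "\<And>v. v \<in> V \<Longrightarrow> card (V - E `` {v}) \<le> (1 / r + 1 / (80 * r ^ 3)) * card V"
    and size: "32 * r\<^sup>2 * 4 ^ (64 * r\<^sup>2 * s * (2 * r) ^ r) \<le> card V"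
    and free: "\<not> contains_multipartite_plus E r s"
  shows "\<exists>p \<in> V \<rightarrow> {..<r}. proper_coloring V E p"
proof -
  let ?a = "(1 / r + 1 / (80 * r ^ 3)) * card V" and ?z = "card V / (8 * r\<^sup>2)"
  define l where "l = card V / (8 * r)"
  have z_eq: "?z = l / r" by (simp add: l_def power2_eq_square)
  have "4 * r * 4 ^ (64 * r\<^sup>2 * s * (2 * r) ^ r) \<le> 32 * r\<^sup>2 * 4 ^ (64 * r\<^sup>2 * s * (2 * r) ^ r)"
    by (simp add: power2_eq_square)
  then have "4 * r * 4 ^ (64 * r\<^sup>2 * s * (2 * r) ^ r) \<le> card V" using size by linarith
  then obtain W where "independent_clusters E V r W ?a ?z"
    using ex_independent_clusters[OF assms(1-5) _ free] by blast
  then interpret independent_clusters E V r W ?a ?z .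
  have "multipartite_rich E r s l W"
  proof (rule multipartite_rich_clusters[OF \<open>s > 0\<close>])
    have "(4 :: nat) ^ (s * (2 * r) ^ r) \<le> 4 ^ (64 * r\<^sup>2 * s * (2 * r) ^ r)"
      using \<open>r \<ge> 2\<close> by (intro power_increasing) auto
    then have "32 * r\<^sup>2 * 4 ^ (s * (2 * r) ^ r) \<le> card V"
      using size by (meson le_trans mult_le_mono2)
    then have "real (32 * r\<^sup>2 * 4 ^ (s * (2 * r) ^ r)) \<le> card V" by (simp only: of_nat_le_iff)
    then show "real (4 * r * 4 ^ (s * (2 * r) ^ r)) \<le> l"
      using \<open>r \<ge> 2\<close> by (simp add: l_def field_simps power2_eq_square)
    show "?z \<le> l / r" by (rule eq_refl[OF z_eq])
  qed
  moreover have "3 * (?z + l) \<le> ?a"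
  proof -
    have "l / r \<le> l / 2" using \<open>r \<ge> 2\<close> by (intro divide_left_mono) (auto simp: l_def)
    moreover have "0 \<le> l" by (simp add: l_def)
    ultimately have "3 * (?z + l) \<le> 8 * l" unfolding z_eq by simp
    also have "8 * l \<le> ?a" by (simp add: l_def distrib_right)
    finally show ?thesis .
  qed
  ultimately show ?thesis
    using assms free by (intro ex_proper_coloring) (auto simp: l_def)
qed

section \<open>The largest eigenvalue\<close>

definition adj_sum :: "'a set \<Rightarrow> 'a rel \<Rightarrow> ('a \<Rightarrow> real) \<Rightarrow> 'a \<Rightarrow> real" where
  "adj_sum V E x u = sum x (V \<inter> E `` {u})"

definition adj_form :: "'a set \<Rightarrow> 'a rel \<Rightarrow> ('a \<Rightarrow> real) \<Rightarrow> ('a \<Rightarrow> real) \<Rightarrow> real" where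
  "adj_form V E x y = (\<Sum>u\<in>V. x u * adj_sum V E y u)"

lemma adj_sum_add_scaled:
  "adj_sum V E (\<lambda>v. x v + t * y v) u = adj_sum V E x u + t * adj_sum V E y u"
  by (simp add: adj_sum_def sum.distrib sum_distrib_left)

lemma adj_form_commute:
  assumes "finite V" "sym E"
  shows "adj_form V E x y = adj_form V E y x"
proof -
  have inter: "V \<inter> E `` {u} = {v \<in> V. (u, v) \<in> E}" for u by auto
  have "adj_form V E x y = (\<Sum>u\<in>V. \<Sum>v\<in>{v \<in> V. (u, v) \<in> E}. x u * y v)"
    by (simp add: adj_form_def adj_sum_def inter sum_distrib_left)
  also have "\<dots> = (\<Sum>v\<in>V. \<Sum>u\<in>{u \<in> V. (u, v) \<in> E}. x u * y v)"
    using \<open>finite V\<close> by (rule sum.swap_restrict) (rule \<open>finite V\<close>)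
  also have "\<dots> = (\<Sum>v\<in>V. \<Sum>u\<in>{u \<in> V. (v, u) \<in> E}. y v * x u)"
    using \<open>sym E\<close> by (intro sum.cong) (auto dest: symD)
  also have "\<dots> = adj_form V E y x"
    by (simp add: adj_form_def adj_sum_def inter sum_distrib_left)
  finally show ?thesis .
qed

lemma adj_form_add_scaled:
  assumes "finite V" "sym E"
  shows "adj_form V E (\<lambda>v. x v + t * y v) (\<lambda>v. x v + t * y v) =
    adj_form V E x x + 2 * t * adj_form V E y x + t\<^sup>2 * adj_form V E y y"
proof -
  have "adj_form V E (\<lambda>v. x v + t * y v) (\<lambda>v. x v + t * y v) =
    adj_form V E x x + t * adj_form V E x y + t * adj_form V E y x + t\<^sup>2 * adj_form V E y y"
    unfolding adj_form_def adj_sum_add_scaled sum_distrib_left sum.distrib[symmetric]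
    by (intro sum.cong refl) (simp add: algebra_simps power2_eq_square)
  then show ?thesis using adj_form_commute[OF assms, of x y] by simp
qed

lemma adj_form_scale:
  assumes "\<And>v. v \<in> V \<Longrightarrow> y v = c * x v"
  shows "adj_form V E y y = c\<^sup>2 * adj_form V E x x"
  unfolding adj_form_def adj_sum_def sum_distrib_left using assms
  by (intro sum.cong) (auto simp: power2_eq_square sum_distrib_left intro!: sum.cong)

lemma adj_form_abs_ge: "adj_form V E x x \<le> adj_form V E (\<lambda>v. \<bar>x v\<bar>) (\<lambda>v. \<bar>x v\<bar>)"
proof -
  have "x u * x v \<le> \<bar>x u\<bar> * \<bar>x v\<bar>" for u v
    using abs_ge_self[of "x u * x v"] by (simp add: abs_mult)
  then show ?thesis
    unfolding adj_form_def adj_sum_def sum_distrib_left by (intro sum_mono)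
qed

lemma adj_form_eigenvector:
  assumes "\<And>u. u \<in> V \<Longrightarrow> adj_sum V E x u = m * x u"
  shows "adj_form V E x x = m * (\<Sum>v\<in>V. (x v)\<^sup>2)"
  unfolding adj_form_def sum_distrib_left using assms
  by (intro sum.cong) (auto simp: power2_eq_square)

lemma compact_unit_sphere_supported:
  fixes V :: "'a set"
  assumes "finite V"
  shows "compact {x :: 'a \<Rightarrow> real. (\<forall>v. v \<notin> V \<longrightarrow> x v = 0) \<and> (\<Sum>v\<in>V. (x v)\<^sup>2) = 1}"
    (is "compact ?S")
proof -
  define K :: "('a \<Rightarrow> real) set" where "K = PiE UNIV (\<lambda>v. if v \<in> V then {-1..1} else {0})"
  have "compactin (product_topology (\<lambda>i. euclidean) UNIV) K"
    unfolding K_def by (subst compactin_PiE) auto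
  then have "compact K" by (simp add: euclidean_product_topology)
  moreover have "closed {x :: 'a \<Rightarrow> real. (\<Sum>v\<in>V. (x v)\<^sup>2) = 1}"
    by (intro closed_Collect_eq continuous_intros continuous_on_product_coordinates)
  ultimately have "compact (K \<inter> {x. (\<Sum>v\<in>V. (x v)\<^sup>2) = 1})" by (rule compact_Int_closed)
  moreover have "x v \<in> {-1..1}" if "x \<in> ?S" "v \<in> V" for x v
  proof -
    have "(x v)\<^sup>2 \<le> (\<Sum>v\<in>V. (x v)\<^sup>2)" using that \<open>finite V\<close> by (intro member_le_sum) auto
    then show ?thesis using that abs_le_square_iff[of "x v" 1] by (auto simp: abs_le_iff)
  qed
  then have "?S = K \<inter> {x. (\<Sum>v\<in>V. (x v)\<^sup>2) = 1}"
    by (auto simp: K_def PiE_UNIV_domain Pi_def split: if_splits)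
  ultimately show ?thesis by simp
qed

lemma continuous_on_adj_form: "continuous_on S (\<lambda>x. adj_form V E x x)"
proof (rule continuous_on_subset)
  show "continuous_on UNIV (\<lambda>x. adj_form V E x x)"
    unfolding adj_form_def adj_sum_def
    by (intro continuous_on_sum continuous_on_mult continuous_on_product_coordinates)
qed simp

lemma ex_rayleigh_maximizer:
  fixes V :: "'a set"
  assumes "finite V" "V \<noteq> {}"
  shows "\<exists>x. (\<Sum>v\<in>V. (x v)\<^sup>2) = 1 \<and> (\<forall>y. adj_form V E y y \<le> adj_form V E x x * (\<Sum>v\<in>V. (y v)\<^sup>2))"
proof -
  define S where "S = {x :: 'a \<Rightarrow> real. (\<forall>v. v \<notin> V \<longrightarrow> x v = 0) \<and> (\<Sum>v\<in>V. (x v)\<^sup>2) = 1}"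
  obtain v where "v \<in> V" using assms by auto
  then have "(\<lambda>u. if u = v then 1 else 0) \<in> S"
    using \<open>finite V\<close> by (auto simp: S_def if_distrib[of "\<lambda>a. a ^ 2"] cong: if_cong)
  then have "S \<noteq> {}" by auto
  moreover have "compact S" unfolding S_def using \<open>finite V\<close> by (rule compact_unit_sphere_supported)
  ultimately obtain x where "x \<in> S" and x_max: "\<And>y. y \<in> S \<Longrightarrow> adj_form V E y y \<le> adj_form V E x x"
    using continuous_attains_sup[OF _ _ continuous_on_adj_form] by metis
  have "adj_form V E y y \<le> adj_form V E x x * (\<Sum>v\<in>V. (y v)\<^sup>2)" for y
  proof (cases "(\<Sum>v\<in>V. (y v)\<^sup>2) = 0")
    case True
    then have "y v = 0 * y v" if "v \<in> V" for v
      using that \<open>finite V\<close> by (simp add: sum_nonneg_eq_0_iff)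
    then have "adj_form V E y y = 0\<^sup>2 * adj_form V E y y" by (rule adj_form_scale)
    then show ?thesis using True by simp
  next
    case False
    define N where "N = (\<Sum>v\<in>V. (y v)\<^sup>2)"
    have "N > 0" using False sum_nonneg[of V "\<lambda>v. (y v)\<^sup>2"] unfolding N_def by simp
    define z where "z v = (if v \<in> V then y v / sqrt N else 0)" for v
    have "(\<Sum>v\<in>V. (z v)\<^sup>2) = 1"
      using \<open>N > 0\<close> by (simp add: z_def power_divide flip: sum_divide_distrib N_def)
    then have "adj_form V E z z \<le> adj_form V E x x" by (intro x_max) (simp add: S_def z_def)
    moreover have "adj_form V E z z = (1 / sqrt N)\<^sup>2 * adj_form V E y y"
      by (rule adj_form_scale) (simp add: z_def)
    ultimately show ?thesis using \<open>N > 0\<close> by (simp add: power_divide field_simps flip: N_def)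
  qed
  then show ?thesis using \<open>x \<in> S\<close> by (auto simp: S_def)
qed

lemma linear_le_quadratic_imp_nonpos:
  fixes b c :: real
  assumes "\<And>t. 2 * t * b \<le> t\<^sup>2 * c"
  shows "b \<le> 0"
proof (rule ccontr)
  assume "\<not> b \<le> 0"
  define t where "t = b / (\<bar>c\<bar> + 1)"
  have "t > 0" and t_eq: "t * (\<bar>c\<bar> + 1) = b" using \<open>\<not> b \<le> 0\<close> by (simp_all add: t_def)
  have "t * (2 * b) \<le> t * (t * c)" using assms[of t] by (simp add: power2_eq_square algebra_simps)
  then have "2 * b \<le> t * c" using \<open>t > 0\<close> by simp
  also have "\<dots> \<le> t * (\<bar>c\<bar> + 1)" using \<open>t > 0\<close> by (intro mult_left_mono) auto
  finally show False using t_eq \<open>\<not> b \<le> 0\<close> by simp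
qed

text \<open>Perturbing a maximizer in the direction of its own residual shows that the residual vanishes.\<close>

lemma rayleigh_maximizer_is_eigenvector:
  assumes "finite V" "sym E" and norm: "(\<Sum>v\<in>V. (x v)\<^sup>2) = 1" and "m \<le> adj_form V E x x"
    and max: "\<And>y. adj_form V E y y \<le> m * (\<Sum>v\<in>V. (y v)\<^sup>2)"
    and "u \<in> V"
  shows "adj_sum V E x u = m * x u"
proof -
  define h where "h v = adj_sum V E x v - m * x v" for v
  have residual: "adj_form V E h x - m * (\<Sum>v\<in>V. h v * x v) = (\<Sum>v\<in>V. (h v)\<^sup>2)"
    unfolding adj_form_def sum_distrib_left sum_subtractf[symmetric]
    by (intro sum.cong refl) (simp add: h_def algebra_simps power2_eq_square)
  have "(\<Sum>v\<in>V. (h v)\<^sup>2) \<le> 0"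
  proof (rule linear_le_quadratic_imp_nonpos)
    fix t :: real
    have "adj_form V E x x + 2 * t * adj_form V E h x + t\<^sup>2 * adj_form V E h h
      \<le> m * (\<Sum>v\<in>V. (x v + t * h v)\<^sup>2)"
      using max[of "\<lambda>v. x v + t * h v"] adj_form_add_scaled[OF assms(1,2), of x t h] by simp
    also have "(\<Sum>v\<in>V. (x v + t * h v)\<^sup>2) =
        (\<Sum>v\<in>V. (x v)\<^sup>2) + 2 * t * (\<Sum>v\<in>V. h v * x v) + t\<^sup>2 * (\<Sum>v\<in>V. (h v)\<^sup>2)"
      unfolding sum_distrib_left sum.distrib[symmetric]
      by (intro sum.cong refl) (simp add: algebra_simps power2_eq_square)
    finally have "2 * t * (adj_form V E h x - m * (\<Sum>v\<in>V. h v * x v))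
      \<le> t\<^sup>2 * (m * (\<Sum>v\<in>V. (h v)\<^sup>2) - adj_form V E h h)"
      using assms(4) norm by (simp add: algebra_simps)
    then show "2 * t * (\<Sum>v\<in>V. (h v)\<^sup>2) \<le> t\<^sup>2 * (m * (\<Sum>v\<in>V. (h v)\<^sup>2) - adj_form V E h h)"
      by (simp only: residual)
  qed
  then have "(\<Sum>v\<in>V. (h v)\<^sup>2) = 0" by (intro antisym sum_nonneg) auto
  then show ?thesis using \<open>finite V\<close> \<open>u \<in> V\<close> by (simp add: sum_nonneg_eq_0_iff h_def)
qed

lemma ex_perron_vector:
  fixes V :: "'a set"
  assumes "finite V" "V \<noteq> {}" "sym E"
  shows "\<exists>\<mu> x. (\<forall>v. 0 \<le> x v) \<and> (\<Sum>v\<in>V. (x v)\<^sup>2) = 1 \<and> (\<forall>u\<in>V. adj_sum V E x u = \<mu> * x u) \<and>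
    (\<forall>y. adj_form V E y y \<le> \<mu> * (\<Sum>v\<in>V. (y v)\<^sup>2))"
proof -
  obtain x where maximizer: "(\<Sum>v\<in>V. (x v)\<^sup>2) = 1"
    "\<And>y. adj_form V E y y \<le> adj_form V E x x * (\<Sum>v\<in>V. (y v)\<^sup>2)"
    using ex_rayleigh_maximizer[OF assms(1,2)] by blast
  have "adj_sum V E (\<lambda>v. \<bar>x v\<bar>) u = adj_form V E x x * \<bar>x u\<bar>" if "u \<in> V" for u
    using assms(1,3) maximizer adj_form_abs_ge that
    by (intro rayleigh_maximizer_is_eigenvector) auto
  then show ?thesis
    using maximizer by (intro exI[of _ "adj_form V E x x"] exI[of _ "\<lambda>v. \<bar>x v\<bar>"]) auto
qed

text \<open>
  Only the arcs of \<open>E\<close> inside \<open>V\<close> matter, so \<open>top_eigenvalue W E\<close> for \<open>W \<subseteq> V\<close> is the largest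
  eigenvalue of the induced subgraph.
\<close>

abbreviation top_eigenvalue :: "'a set \<Rightarrow> 'a rel \<Rightarrow> real" where
  "top_eigenvalue V E \<equiv> largest_eigenvalue \<lparr>pverts = V, parcs = E\<rparr>"

lemma top_eigenvalue_graph: "top_eigenvalue (pverts G) (parcs G) = largest_eigenvalue G"
  by (cases G) simp

lemma in_spectrum_adjacency_matrix_iff:
  assumes "finite V"
  shows "k \<in> spectrum (adjacency_matrix \<lparr>pverts = V, parcs = E\<rparr>) \<longleftrightarrow>
    (\<exists>f. (\<exists>v\<in>V. f v \<noteq> 0) \<and> (\<forall>u\<in>V. adj_sum V E f u = k * f u))"
proof -
  let ?G = "\<lparr>pverts = V, parcs = E\<rparr>"
  have "(\<Sum>v\<in>V. if (u, v) \<in> E then f v else 0) = adj_sum V E f u" for f u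
    using sum.inter_restrict[OF assms, of f "E `` {u}"] by (simp add: adj_sum_def)
  moreover have "distinct (vertex_list ?G)" "set (vertex_list ?G) = pverts ?G"
    using vertex_list[of ?G] assms by auto
  ultimately show ?thesis
    using eigenvalue_adjacency_matrix_on[of "vertex_list ?G" ?G k]
    unfolding spectrum_def adjacency_matrix_def by simp
qed

lemma top_eigenvalue_eqI:
  assumes "finite V" and eigenvector: "\<exists>v\<in>V. x v \<noteq> 0" "\<And>u. u \<in> V \<Longrightarrow> adj_sum V E x u = m * x u"
    and max: "\<And>y. adj_form V E y y \<le> m * (\<Sum>v\<in>V. (y v)\<^sup>2)"
  shows "top_eigenvalue V E = m"
  unfolding largest_eigenvalue_def
proof (rule Max_eqI)
  let ?A = "adjacency_matrix \<lparr>pverts = V, parcs = E\<rparr>"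
  have "?A \<in> carrier_mat (dim_row ?A) (dim_row ?A)"
    by (simp add: adjacency_matrix_def adjacency_matrix_on_def)
  then show "finite (spectrum ?A)" by (rule card_finite_spectrum)
  show "m \<in> spectrum ?A"
    using eigenvector unfolding in_spectrum_adjacency_matrix_iff[OF \<open>finite V\<close>] by blast
  show "k \<le> m" if in_spectrum: "k \<in> spectrum ?A" for k
  proof -
    obtain f where f_nonzero: "\<exists>v\<in>V. f v \<noteq> 0"
      and f_eigenvector: "\<And>u. u \<in> V \<Longrightarrow> adj_sum V E f u = k * f u"
      using in_spectrum unfolding in_spectrum_adjacency_matrix_iff[OF \<open>finite V\<close>] by blast
    have "k * (\<Sum>v\<in>V. (f v)\<^sup>2) \<le> m * (\<Sum>v\<in>V. (f v)\<^sup>2)"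
      using adj_form_eigenvector[OF f_eigenvector] max[of f] by simp
    moreover have "0 < (\<Sum>v\<in>V. (f v)\<^sup>2)"
      using f_nonzero \<open>finite V\<close> by (auto intro: sum_pos2)
    ultimately show ?thesis by simp
  qed
qed

lemma top_eigenvalue:
  fixes V :: "'a set"
  assumes "finite V" "V \<noteq> {}" "sym E"
  shows ex_top_eigenvector: "\<exists>x. (\<forall>v. 0 \<le> x v) \<and> (\<Sum>v\<in>V. (x v)\<^sup>2) = 1 \<and>
      (\<forall>u\<in>V. adj_sum V E x u = top_eigenvalue V E * x u)"
    and adj_form_le_top_eigenvalue: "adj_form V E y y \<le> top_eigenvalue V E * (\<Sum>v\<in>V. (y v)\<^sup>2)"
proof -
  obtain m x where nonneg: "\<And>v. 0 \<le> x v" and norm: "(\<Sum>v\<in>V. (x v)\<^sup>2) = 1"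
    and eigenvector: "\<And>u. u \<in> V \<Longrightarrow> adj_sum V E x u = m * x u"
    and max: "\<And>y. adj_form V E y y \<le> m * (\<Sum>v\<in>V. (y v)\<^sup>2)"
    using ex_perron_vector[OF assms] by blast
  have "\<exists>v\<in>V. x v \<noteq> 0" using norm by (rule contrapos_pp) simp
  then have "top_eigenvalue V E = m" using assms(1) eigenvector max by (intro top_eigenvalue_eqI)
  then show "\<exists>x. (\<forall>v. 0 \<le> x v) \<and> (\<Sum>v\<in>V. (x v)\<^sup>2) = 1 \<and>
      (\<forall>u\<in>V. adj_sum V E x u = top_eigenvalue V E * x u)"
    and "adj_form V E y y \<le> top_eigenvalue V E * (\<Sum>v\<in>V. (y v)\<^sup>2)"
    using nonneg norm eigenvector max by auto
qed

lemma sum_pos_if_unit: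
  fixes x :: "'a \<Rightarrow> real"
  assumes "finite V" "\<And>v. 0 \<le> x v" "(\<Sum>v\<in>V. (x v)\<^sup>2) = 1"
  shows "0 < sum x V"
proof -
  have "sum x V \<noteq> 0"
  proof
    assume "sum x V = 0"
    then have "\<forall>v\<in>V. x v = 0" using assms by (simp add: sum_nonneg_eq_0_iff)
    then show False using assms(3) by simp
  qed
  moreover have "0 \<le> sum x V" using assms(2) by (rule sum_nonneg)
  ultimately show ?thesis by simp
qed

lemma top_eigenvalue_geI:
  fixes V :: "'a set"
  assumes graph: "finite V" "V \<noteq> {}" "sym E"
    and y_pos: "\<And>v. v \<in> V \<Longrightarrow> 0 < y v" and subeigenvector: "\<And>v. v \<in> V \<Longrightarrow> k * y v \<le> adj_sum V E y v"
  shows "k \<le> top_eigenvalue V E"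
proof -
  have "k * (\<Sum>v\<in>V. (y v)\<^sup>2) = (\<Sum>v\<in>V. y v * (k * y v))"
    by (simp add: sum_distrib_left power2_eq_square mult_ac)
  also have "\<dots> \<le> adj_form V E y y"
    unfolding adj_form_def using y_pos subeigenvector
    by (intro sum_mono mult_left_mono) (auto intro: less_imp_le)
  also have "\<dots> \<le> top_eigenvalue V E * (\<Sum>v\<in>V. (y v)\<^sup>2)"
    by (rule adj_form_le_top_eigenvalue[OF graph])
  finally have "k * (\<Sum>v\<in>V. (y v)\<^sup>2) \<le> top_eigenvalue V E * (\<Sum>v\<in>V. (y v)\<^sup>2)" .
  moreover have "0 < (\<Sum>v\<in>V. (y v)\<^sup>2)" using graph y_pos by (intro sum_pos zero_less_power) auto
  ultimately show ?thesis by simp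
qed

lemma top_eigenvalue_nonneg:
  assumes "finite V" "V \<noteq> {}" "sym E"
  shows "0 \<le> top_eigenvalue V E"
  using assms by (rule top_eigenvalue_geI[where y = "\<lambda>_. 1"]) (auto simp: adj_sum_def)

lemma top_eigenvalue_le_card:
  assumes "finite V" "V \<noteq> {}" "sym E"
  shows "top_eigenvalue V E \<le> card V"
proof -
  obtain x where nonneg: "\<And>v. 0 \<le> x v" and norm: "(\<Sum>v\<in>V. (x v)\<^sup>2) = 1"
    and eigenvector: "\<And>u. u \<in> V \<Longrightarrow> adj_sum V E x u = top_eigenvalue V E * x u"
    using ex_top_eigenvector[OF assms] by blast
  have "top_eigenvalue V E * sum x V = (\<Sum>u\<in>V. adj_sum V E x u)"
    using eigenvector by (simp add: sum_distrib_left)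
  also have "\<dots> \<le> (\<Sum>u\<in>V. sum x V)"
    unfolding adj_sum_def using nonneg \<open>finite V\<close> by (intro sum_mono sum_mono2) auto
  finally show ?thesis using sum_pos_if_unit[OF \<open>finite V\<close> nonneg norm] by simp
qed

section \<open>Multipartite graphs and the Turan graph\<close>

text \<open>
  For a complete multipartite graph equality holds, and this is the equation of its largest
  eigenvalue.
\<close>

lemma proper_coloring_eigenvalue_equation:
  fixes V :: "'a set" and p :: "'a \<Rightarrow> 'c"
  assumes graph: "finite V" "V \<noteq> {}" "sym E" and "finite I" "p \<in> V \<rightarrow> I"
    and proper: "proper_coloring V E p" and pos: "top_eigenvalue V E > 0"
  shows "1 \<le> (\<Sum>i\<in>I. card {v \<in> V. p v = i} / (top_eigenvalue V E + card {v \<in> V. p v = i}))"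
proof -
  define m where "m = top_eigenvalue V E"
  define C where "C i = {v \<in> V. p v = i}" for i
  obtain x where nonneg: "\<And>v. 0 \<le> x v" and norm: "(\<Sum>v\<in>V. (x v)\<^sup>2) = 1"
    and eigenvector: "\<And>u. u \<in> V \<Longrightarrow> adj_sum V E x u = m * x u"
    using ex_top_eigenvector[OF graph] unfolding m_def by blast
  have "m * x u \<le> sum x V - sum x (C i)" if "u \<in> C i" for u i
  proof -
    have "m * x u = sum x (V \<inter> E `` {u})"
      using eigenvector that by (simp add: C_def flip: adj_sum_def)
    also have "\<dots> \<le> sum x (V - C i)"
    proof (rule sum_mono2)
      show "V \<inter> E `` {u} \<subseteq> V - C i"
        using proper that unfolding C_def proper_coloring_def by force
    qed (use nonneg \<open>finite V\<close> in auto)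
    also have "\<dots> = sum x V - sum x (C i)" using \<open>finite V\<close> by (intro sum_diff) (auto simp: C_def)
    finally show ?thesis .
  qed
  then have "(\<Sum>u\<in>C i. m * x u) \<le> card (C i) * (sum x V - sum x (C i))" for i
    by (rule sum_bounded_above)
  then have "m * sum x (C i) \<le> card (C i) * (sum x V - sum x (C i))" for i
    by (simp add: sum_distrib_left)
  then have class_le: "sum x (C i) \<le> card (C i) / (m + card (C i)) * sum x V" for i
    using pos by (simp add: m_def field_simps)
  have "sum x V = (\<Sum>i\<in>I. sum x (C i))"
    unfolding C_def using \<open>finite V\<close> \<open>finite I\<close> \<open>p \<in> V \<rightarrow> I\<close> by (intro sum.group[symmetric]) auto
  also have "\<dots> \<le> (\<Sum>i\<in>I. card (C i) / (m + card (C i))) * sum x V"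
    unfolding sum_distrib_right by (intro sum_mono class_le)
  finally show ?thesis
    using sum_pos_if_unit[OF \<open>finite V\<close> nonneg norm] by (simp add: m_def C_def)
qed

lemma sum_card_color_classes:
  assumes "finite V" "finite I" "p \<in> V \<rightarrow> I"
  shows "(\<Sum>i\<in>I. real (card {v \<in> V. p v = i})) = card V"
  using sum.group[of V I p "\<lambda>_. 1 :: real"] assms by auto

text \<open>
  The slope of the secant of \<open>k / (m + k)\<close> through \<open>a\<close> and \<open>b\<close> is \<open>m / ((m + a) (m + b))\<close>; for
  \<open>a = b\<close> it becomes the tangent.
\<close>

lemma ratio_le_secant:
  fixes m a b k :: real
  assumes "m > 0" "0 \<le> a" "0 \<le> b" "0 \<le> k" "0 \<le> (k - a) * (k - b)"
  shows "k / (m + k) \<le> a / (m + a) + (k - a) * (m / ((m + a) * (m + b)))"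
proof -
  have "m + k \<noteq> 0" "m + a \<noteq> 0" "m + b \<noteq> 0" using assms by linarith+
  then have "a / (m + a) + (k - a) * (m / ((m + a) * (m + b))) - k / (m + k) =
    m * ((k - a) * (k - b)) / ((m + k) * (m + a) * (m + b))"
    by (simp add: divide_simps) (simp add: algebra_simps)
  also have "\<dots> \<ge> 0" using assms by simp
  finally show ?thesis by simp
qed

lemma sum_ratio_le_secant:
  fixes m a b :: real and c :: "'i \<Rightarrow> real"
  assumes "m > 0" "0 \<le> a" "0 \<le> b"
    and "\<And>i. i \<in> I \<Longrightarrow> 0 \<le> c i" "\<And>i. i \<in> I \<Longrightarrow> 0 \<le> (c i - a) * (c i - b)"
  shows "(\<Sum>i\<in>I. c i / (m + c i)) \<le>
    card I * (a / (m + a)) + (sum c I - card I * a) * (m / ((m + a) * (m + b)))"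
proof -
  have "(\<Sum>i\<in>I. c i / (m + c i)) \<le> (\<Sum>i\<in>I. a / (m + a) + (c i - a) * (m / ((m + a) * (m + b))))"
    using assms by (intro sum_mono ratio_le_secant) auto
  also have "\<dots> = card I * (a / (m + a)) + (sum c I - card I * a) * (m / ((m + a) * (m + b)))"
    by (simp only: sum.distrib sum_subtractf sum_constant flip: sum_distrib_right)
  finally show ?thesis .
qed

lemma top_eigenvalue_proper_coloring_le:
  assumes graph: "finite V" "V \<noteq> {}" "sym E"
    and coloring: "finite I" "p \<in> V \<rightarrow> I" "proper_coloring V E p"
  shows "top_eigenvalue V E \<le> (1 - 1 / card I) * card V"
proof (cases "top_eigenvalue V E > 0")
  case False
  have "1 / real (card I) \<le> 1" by (cases "card I = 0") auto
  then have "0 \<le> (1 - 1 / real (card I)) * card V" by simp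
  then show ?thesis using False by linarith
next
  case True
  define m where "m = top_eigenvalue V E"
  define c where "c i = real (card {v \<in> V. p v = i})" for i
  define a where "a = card V / real (card I)"
  have "m > 0" using True by (simp add: m_def)
  have "I \<noteq> {}" using coloring(2) graph(2) by auto
  then have average: "card I * a = card V" using coloring(1) by (simp add: a_def)
  have "1 \<le> (\<Sum>i\<in>I. c i / (m + c i))"
    using proper_coloring_eigenvalue_equation[OF graph coloring True] by (simp add: m_def c_def)
  also have "\<dots> \<le> card I * (a / (m + a)) + (sum c I - card I * a) * (m / ((m + a) * (m + a)))"
    using \<open>m > 0\<close> by (intro sum_ratio_le_secant) (auto simp: a_def c_def)
  also have "sum c I = card V"
    unfolding c_def using graph(1) coloring(1,2) by (rule sum_card_color_classes)
  also have "card I * (a / (m + a)) + (card V - card I * a) * (m / ((m + a) * (m + a))) =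
    card V / (m + a)"
    by (simp add: average)
  finally have "1 \<le> card V / (m + a)" .
  moreover have "m + a > 0" using \<open>m > 0\<close> by (simp add: a_def add_pos_nonneg)
  ultimately have "m + a \<le> card V" by simp
  then show ?thesis by (simp add: m_def a_def algebra_simps)
qed

lemma sym_parcs_complete_multipartite: "sym (parcs (complete_multipartite ss))"
  by (auto simp: parcs_complete_multipartite intro: symI)

lemma sum_pverts_complete_multipartite:
  fixes g :: "nat \<Rightarrow> real"
  shows "(\<Sum>v\<in>pverts (complete_multipartite ss). g (fst v)) = (\<Sum>i<length ss. real (ss ! i) * g i)"
proof -
  have "(\<Sum>v\<in>pverts (complete_multipartite ss). g (fst v)) = (\<Sum>i<length ss. \<Sum>j<ss ! i. g i)"
    unfolding pverts_complete_multipartite by (subst sum.Sigma) (auto intro!: sum.cong)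
  then show ?thesis by simp
qed

lemma adj_sum_complete_multipartite:
  fixes g :: "nat \<Rightarrow> real" and ss :: "nat list"
  defines "K \<equiv> complete_multipartite ss"
  assumes "u \<in> pverts K"
  shows "adj_sum (pverts K) (parcs K) (\<lambda>v. g (fst v)) u =
    (\<Sum>i<length ss. real (ss ! i) * g i) - real (ss ! fst u) * g (fst u)"
proof -
  have fst_u: "fst u < length ss" using assms by (auto simp: pverts_complete_multipartite)
  have "pverts K \<inter> parcs K `` {u} = {v \<in> pverts K. fst v \<noteq> fst u}"
    using assms by (auto simp: parcs_complete_multipartite)
  then have "adj_sum (pverts K) (parcs K) (\<lambda>v. g (fst v)) u =
      (\<Sum>v\<in>pverts K. if fst v \<noteq> fst u then g (fst v) else 0)"
    unfolding adj_sum_def K_def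
    by (simp add: sum.inter_filter finite_pverts_complete_multipartite)
  also have "\<dots> = (\<Sum>i<length ss. real (ss ! i) * (if i \<noteq> fst u then g i else 0))"
    unfolding K_def
    by (rule sum_pverts_complete_multipartite[where g = "\<lambda>i. if i \<noteq> fst u then g i else 0"])
  also have "\<dots> = (\<Sum>i\<in>{..<length ss} - {fst u}. real (ss ! i) * g i)"
    using fst_u by (intro sum.mono_neutral_cong_right) auto
  also have "\<dots> = (\<Sum>i<length ss. real (ss ! i) * g i) - real (ss ! fst u) * g (fst u)"
    using fst_u by (simp add: sum_diff1)
  finally show ?thesis .
qed

lemma largest_eigenvalue_complete_multipartite_geI:
  fixes m :: real
  assumes "m > 0" and sum_ge: "1 \<le> (\<Sum>i<length ss. real (ss ! i) / (m + real (ss ! i)))"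
  shows "m \<le> largest_eigenvalue (complete_multipartite ss)"
proof -
  let ?V = "pverts (complete_multipartite ss)" and ?E = "parcs (complete_multipartite ss)"
  define y where "y i = 1 / (m + real (ss ! i))" for i
  have y_weights: "0 < y i" "m * y i = 1 - real (ss ! i) * y i" for i
    using \<open>m > 0\<close> by (auto simp: y_def field_simps add_pos_nonneg)
  have "?V \<noteq> {}"
  proof
    assume "?V = {}"
    then have "ss ! i = 0" if "i < length ss" for i
      using that by (auto simp: pverts_complete_multipartite)
    then show False using sum_ge by simp
  qed
  then have "m \<le> top_eigenvalue ?V ?E"
  proof (rule top_eigenvalue_geI[where y = "\<lambda>v. y (fst v)", rotated 1])
    show "m * y (fst v) \<le> adj_sum ?V ?E (\<lambda>v. y (fst v)) v" if "v \<in> ?V" for v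
      using sum_ge that by (simp add: adj_sum_complete_multipartite y_weights) (simp add: y_def)
  qed (simp_all add: finite_pverts_complete_multipartite sym_parcs_complete_multipartite y_weights)
  then show ?thesis by (simp only: top_eigenvalue_graph)
qed

lemma largest_eigenvalue_complete_multipartite_ge:
  fixes ss :: "nat list"
  defines "n \<equiv> real (\<Sum>i<length ss. ss ! i)"
  assumes "n > 0"
  shows "n * n - (\<Sum>i<length ss. (real (ss ! i))\<^sup>2) \<le>
    largest_eigenvalue (complete_multipartite ss) * n"
proof -
  let ?V = "pverts (complete_multipartite ss)" and ?E = "parcs (complete_multipartite ss)"
  have card: "real (card ?V) = n"
    using sum_pverts_complete_multipartite[of "\<lambda>_. 1" ss] by (simp add: n_def)
  have "adj_form ?V ?E (\<lambda>_. 1) (\<lambda>_. 1) = (\<Sum>u\<in>?V. n - real (ss ! fst u))"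
    unfolding adj_form_def using adj_sum_complete_multipartite[of _ ss "\<lambda>_. 1"]
    by (intro sum.cong refl) (simp add: n_def)
  also have "\<dots> = (\<Sum>i<length ss. real (ss ! i) * (n - real (ss ! i)))"
    by (rule sum_pverts_complete_multipartite)
  also have "\<dots> = n * n - (\<Sum>i<length ss. (real (ss ! i))\<^sup>2)"
    by (simp add: n_def right_diff_distrib sum_subtractf sum_distrib_right power2_eq_square)
  finally show ?thesis
    using adj_form_le_top_eigenvalue[of ?V ?E "\<lambda>_. 1"] card \<open>n > 0\<close>
    by (force simp: top_eigenvalue_graph finite_pverts_complete_multipartite
        sym_parcs_complete_multipartite)
qed

definition turan_part :: "nat \<Rightarrow> nat \<Rightarrow> nat \<Rightarrow> nat" where
  "turan_part r n i = n div r + (if i < n mod r then 1 else 0)"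

lemma turan_graph_eq: "turan_graph r n = complete_multipartite (map (turan_part r n) [0..<r])"
  by (simp add: turan_graph_def turan_part_def[abs_def])

lemma sum_turan_part:
  fixes h :: "nat \<Rightarrow> real"
  assumes "r > 0"
  shows "(\<Sum>i<r. h (turan_part r n i)) =
    r * h (n div r) + real (n mod r) * (h (n div r + 1) - h (n div r))"
proof -
  have "{..<r} \<inter> {i. i < n mod r} = {..<n mod r}"
    using mod_less_divisor[OF assms, of n] by auto
  moreover have "h (turan_part r n i) =
      h (n div r) + (if i < n mod r then h (n div r + 1) - h (n div r) else 0)" for i
    by (simp add: turan_part_def)
  ultimately show ?thesis by (simp add: sum.distrib sum.If_cases)
qed

lemma real_div_mod_eq: "real r * real (n div r) + real (n mod r) = real n"
  by (metis mult_div_mod_eq of_nat_add of_nat_mult)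

lemma sum_turan_part_eq:
  assumes "r > 0"
  shows "(\<Sum>i<r. real (turan_part r n i)) = n"
  using sum_turan_part[OF assms, of real n] real_div_mod_eq[of r n] by simp

lemma turan_part_near_average:
  assumes "r > 0"
  shows "\<bar>turan_part r n i - n / r\<bar> \<le> 1"
proof -
  have "real n / r = real (n div r) + real (n mod r) / r"
    using real_div_mod_eq[of r n] assms by (simp add: field_simps)
  moreover have "0 \<le> real (n mod r) / r" "real (n mod r) / r \<le> 1"
    using mod_less_divisor[OF assms, of n] by (simp_all add: divide_le_eq_1)
  ultimately show ?thesis by (auto simp: turan_part_def)
qed

lemma largest_eigenvalue_turan_graph_ge:
  assumes "r > 0" "n > 0"
  shows "(1 - 1 / r) * n - r / n \<le> largest_eigenvalue (turan_graph r n)"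
proof -
  define t where "t i = real (turan_part r n i)" for i
  define a where "a = n / real r"
  have sum_t: "(\<Sum>i<r. t i) = n" unfolding t_def by (rule sum_turan_part_eq[OF \<open>r > 0\<close>])
  have "(\<Sum>i<r. (t i)\<^sup>2) = (\<Sum>i<r. (t i - a)\<^sup>2 + 2 * a * t i - a\<^sup>2)"
    by (simp add: power2_diff)
  also have "\<dots> = (\<Sum>i<r. (t i - a)\<^sup>2) + 2 * a * n - r * a\<^sup>2"
    by (simp add: sum.distrib sum_subtractf sum_t flip: sum_distrib_left)
  also have "\<dots> = (\<Sum>i<r. (t i - a)\<^sup>2) + n * n / r"
    using \<open>r > 0\<close> by (simp add: a_def power2_eq_square)
  also have "(\<Sum>i<r. (t i - a)\<^sup>2) \<le> r"
  proof -
    have "(t i - a)\<^sup>2 \<le> 1" for i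
      using turan_part_near_average[OF \<open>r > 0\<close>] by (simp add: t_def a_def abs_square_le_1)
    then show ?thesis using sum_bounded_above[of "{..<r}" "\<lambda>i. (t i - a)\<^sup>2" 1] by simp
  qed
  finally have squares: "(\<Sum>i<r. (t i)\<^sup>2) \<le> r + n * n / r" by simp
  have "n * n - (\<Sum>i<r. (t i)\<^sup>2) \<le> largest_eigenvalue (turan_graph r n) * n"
    using largest_eigenvalue_complete_multipartite_ge[of "map (turan_part r n) [0..<r]"] sum_t
      \<open>n > 0\<close>
    by (simp add: turan_graph_eq t_def)
  with squares have "n * n - n * n / r - r \<le> largest_eigenvalue (turan_graph r n) * n" by simp
  then have "(n * n - n * n / r - r) / n \<le> largest_eigenvalue (turan_graph r n)"
    using \<open>n > 0\<close> by (simp add: divide_le_eq)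
  moreover have "(n * n - n * n / r - r) / real n = (1 - 1 / r) * n - r / n"
    using assms by (simp add: field_simps)
  ultimately show ?thesis by simp
qed

lemma sum_ratio_le_turan:
  fixes m :: real and c :: "nat \<Rightarrow> nat"
  assumes "m > 0" "r > 0" and sum_c: "(\<Sum>i<r. c i) = n"
  shows "(\<Sum>i<r. c i / (m + c i)) \<le> (\<Sum>i<r. turan_part r n i / (m + turan_part r n i))"
proof -
  define q where "q = n div r"
  have "(\<Sum>i<r. c i / (m + c i)) \<le> card {..<r} * (real q / (m + q)) +
      ((\<Sum>i<r. real (c i)) - card {..<r} * real q) * (m / ((m + q) * (m + (real q + 1))))"
  proof (rule sum_ratio_le_secant[OF \<open>m > 0\<close>])
    show "0 \<le> (real (c i) - q) * (c i - (real q + 1))" for i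
      by (cases "c i \<le> q") (auto intro: mult_nonpos_nonpos)
  qed auto
  also have "\<dots> = r * (real q / (m + q)) + real (n mod r) * (m / ((m + q) * (m + (real q + 1))))"
  proof -
    have "(\<Sum>i<r. real (c i)) - r * real q = real (n mod r)"
      using real_div_mod_eq[of r n] sum_c by (simp add: q_def flip: of_nat_sum)
    then show ?thesis by simp
  qed
  also have "m / ((m + q) * (m + (real q + 1))) =
      real (q + 1) / (m + real (q + 1)) - real q / (m + q)"
  proof -
    have "m + q \<noteq> 0" "m + (real q + 1) \<noteq> 0" using \<open>m > 0\<close> by linarith+
    then show ?thesis by (simp add: divide_simps) (simp add: algebra_simps)
  qed
  also have "r * (real q / (m + q)) +
      real (n mod r) * (real (q + 1) / (m + real (q + 1)) - real q / (m + q)) =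
      (\<Sum>i<r. turan_part r n i / (m + turan_part r n i))"
    using sum_turan_part[OF \<open>r > 0\<close>, of "\<lambda>k. k / (m + k)" n] by (simp add: q_def)
  finally show ?thesis .
qed

lemma top_eigenvalue_proper_coloring_le_turan:
  assumes graph: "finite V" "V \<noteq> {}" "sym E" and coloring: "p \<in> V \<rightarrow> {..<r}" "proper_coloring V E p"
  shows "top_eigenvalue V E \<le> largest_eigenvalue (turan_graph r (card V))"
proof -
  have "r > 0" using coloring(1) graph(2) by (cases r) auto
  show ?thesis
  proof (cases "top_eigenvalue V E > 0")
    case False
    let ?T = "turan_graph r (card V)"
    have "pverts ?T \<noteq> {}"
      using card_turan_graph[OF \<open>r > 0\<close>, of "card V"] graph by (metis card.empty card_eq_0_iff)
    then have "0 \<le> top_eigenvalue (pverts ?T) (parcs ?T)"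
      unfolding turan_graph_eq
      by (intro top_eigenvalue_nonneg finite_pverts_complete_multipartite
          sym_parcs_complete_multipartite)
    then have "0 \<le> largest_eigenvalue ?T" by (simp only: top_eigenvalue_graph)
    then show ?thesis using False by simp
  next
    case True
    let ?c = "\<lambda>i. card {v \<in> V. p v = i}"
    have "1 \<le> (\<Sum>i<r. ?c i / (top_eigenvalue V E + ?c i))"
      using graph coloring True by (intro proper_coloring_eigenvalue_equation) auto
    also have "\<dots> \<le> (\<Sum>i<r. turan_part r (card V) i / (top_eigenvalue V E + turan_part r (card V) i))"
    proof (rule sum_ratio_le_turan[OF True \<open>r > 0\<close>])
      show "(\<Sum>i<r. ?c i) = card V"
        using sum_card_color_classes[OF graph(1) _ coloring(1)] by (simp flip: of_nat_sum)
    qed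
    finally show ?thesis
      unfolding turan_graph_eq using True
      by (intro largest_eigenvalue_complete_multipartite_geI) auto
  qed
qed

section \<open>Passing to an induced subgraph of large minimum degree\<close>

lemma adj_form_delete:
  assumes "finite W" "w \<in> W" "sym E" "(w, w) \<notin> E"
  shows "adj_form (W - {w}) E x x = adj_form W E x x - 2 * x w * adj_sum W E x w"
proof -
  have delete: "adj_sum (W - {w}) E x u = adj_sum W E x u - (if (u, w) \<in> E then x w else 0)" for u
  proof -
    have "(W - {w}) \<inter> E `` {u} = W \<inter> E `` {u} - {w}" by auto
    then show ?thesis using assms by (simp add: adj_sum_def sum_diff1)
  qed
  have "(\<Sum>u\<in>W - {w}. x u * (if (u, w) \<in> E then x w else 0)) = (\<Sum>u\<in>W \<inter> E `` {w}. x u * x w)"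
    using assms by (intro sum.mono_neutral_cong_right) (auto dest: symD)
  also have "\<dots> = x w * adj_sum W E x w"
    by (simp add: adj_sum_def mult.commute flip: sum_distrib_right)
  finally have "adj_form (W - {w}) E x x =
      (\<Sum>u\<in>W - {w}. x u * adj_sum W E x u) - x w * adj_sum W E x w"
    by (simp add: adj_form_def delete right_diff_distrib sum_subtractf)
  then show ?thesis using assms by (simp add: adj_form_def sum_diff1)
qed

lemma top_eigenvalue_delete_ge:
  assumes "finite W" "w \<in> W" "W - {w} \<noteq> {}" "sym E" "(w, w) \<notin> E"
    and "(\<Sum>v\<in>W. (x v)\<^sup>2) = 1" and eigenvector: "\<And>u. u \<in> W \<Longrightarrow> adj_sum W E x u = m * x u"
  shows "m - 2 * m * (x w)\<^sup>2 \<le> top_eigenvalue (W - {w}) E * (1 - (x w)\<^sup>2)"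
proof -
  have "m - 2 * m * (x w)\<^sup>2 = adj_form (W - {w}) E x x"
    using adj_form_delete[of W w E x] adj_form_eigenvector[OF eigenvector] assms
    by (simp add: power2_eq_square)
  also have "\<dots> \<le> top_eigenvalue (W - {w}) E * (\<Sum>v\<in>W - {w}. (x v)\<^sup>2)"
    using assms by (intro adj_form_le_top_eigenvalue) auto
  also have "(\<Sum>v\<in>W - {w}. (x v)\<^sup>2) = 1 - (x w)\<^sup>2" using assms by (simp add: sum_diff1)
  finally show ?thesis .
qed

text \<open>
  Cauchy-Schwarz in the eigenvalue equation at \<open>u\<close>; the vertices not adjacent to \<open>u\<close> carry weight at
  least \<open>a\<close> each.
\<close>

lemma eigenvector_entries_le_degree:
  fixes a m d :: real
  assumes "finite W" "u \<in> W" and norm: "(\<Sum>v\<in>W. (x v)\<^sup>2) = 1"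
    and eigenvector: "adj_sum W E x u = m * x u" and a_le: "\<And>v. v \<in> W \<Longrightarrow> a \<le> (x v)\<^sup>2"
  defines "d \<equiv> real (card (W \<inter> E `` {u}))"
  shows "a * (m\<^sup>2 + d * (card W - d)) \<le> d"
proof -
  define D where "D = W \<inter> E `` {u}"
  have "D \<subseteq> W" by (auto simp: D_def)
  have "real (card (W - D)) * a \<le> (\<Sum>v\<in>W - D. (x v)\<^sup>2)"
    using a_le by (intro sum_bounded_below) auto
  also have "\<dots> = 1 - (\<Sum>v\<in>D. (x v)\<^sup>2)"
    using sum.subset_diff[OF \<open>D \<subseteq> W\<close> \<open>finite W\<close>, of "\<lambda>v. (x v)\<^sup>2"] norm by simp
  also have "real (card (W - D)) = card W - d"
    using \<open>D \<subseteq> W\<close> \<open>finite W\<close>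
    by (simp add: card_Diff_subset finite_subset card_mono of_nat_diff d_def D_def)
  finally have outside: "(\<Sum>v\<in>D. (x v)\<^sup>2) \<le> 1 - (card W - d) * a" by simp
  have "m\<^sup>2 * a \<le> m\<^sup>2 * (x u)\<^sup>2" using a_le[OF \<open>u \<in> W\<close>] by (intro mult_left_mono) auto
  also have "\<dots> = (sum x D)\<^sup>2" using eigenvector by (simp add: adj_sum_def D_def power_mult_distrib)
  also have "\<dots> \<le> (\<Sum>v\<in>D. (x v)\<^sup>2) * d"
    using sum_squared_le_sum_of_squares[of x D] by (simp add: d_def D_def)
  also have "\<dots> \<le> (1 - (card W - d) * a) * d"
    using outside by (intro mult_right_mono) (auto simp: d_def)
  finally show ?thesis by (simp add: algebra_simps)
qed

lemma ex_small_eigenvector_entry: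
  fixes m d \<epsilon> :: real
  assumes "finite W" "u \<in> W" and nonneg: "\<And>v. 0 \<le> x v" and norm: "(\<Sum>v\<in>W. (x v)\<^sup>2) = 1"
    and eigenvector: "adj_sum W E x u = m * x u" and "m > 0"
  defines "d \<equiv> real (card (W \<inter> E `` {u}))"
  assumes low: "d * (d + \<epsilon> * card W) \<le> m\<^sup>2"
  shows "\<exists>w\<in>W. (x w)\<^sup>2 * (card W * (1 + \<epsilon>)) \<le> 1"
proof -
  have "finite (x ` W)" "x ` W \<noteq> {}" using assms by auto
  then obtain w where "w \<in> W" and w_min: "\<And>v. v \<in> W \<Longrightarrow> x w \<le> x v"
    using Min_in[of "x ` W"] Min_le[of "x ` W"] by fastforce
  have "(x w)\<^sup>2 \<le> (x v)\<^sup>2" if "v \<in> W" for v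
    using w_min[OF that] nonneg by (intro power_mono) auto
  then have entry_le: "(x w)\<^sup>2 * (m\<^sup>2 + d * (card W - d)) \<le> d"
    unfolding d_def using assms(1,2) norm eigenvector by (intro eigenvector_entries_le_degree)
  show ?thesis
  proof (cases "d = 0")
    case True
    then have "x w = 0" using entry_le \<open>m > 0\<close> by (simp add: mult_le_0_iff)
    then show ?thesis using \<open>w \<in> W\<close> by (intro bexI[of _ w]) simp_all
  next
    case False
    then have "d > 0" by (simp add: d_def)
    have "(x w)\<^sup>2 * (d * (card W * (1 + \<epsilon>))) \<le> (x w)\<^sup>2 * (m\<^sup>2 + d * (card W - d))"
      using low by (intro mult_left_mono) (auto simp: algebra_simps)
    then have "d * ((x w)\<^sup>2 * (card W * (1 + \<epsilon>))) \<le> d * 1" using entry_le by (simp add: mult_ac)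
    then show ?thesis using \<open>d > 0\<close> \<open>w \<in> W\<close> by (simp only: mult_le_cancel_left_pos) blast
  qed
qed

lemma low_degree_product_le:
  fixes d h k m \<epsilon> :: real and r :: nat
  assumes "0 \<le> d" "0 \<le> h" "0 < \<epsilon>" "\<epsilon> * k\<^sup>2 \<ge> 2 * r" "0 < k"
    and "d \<le> (h - \<epsilon>) * k" "0 \<le> h * k - r / k" "h * k - r / k \<le> m"
  shows "d * (d + \<epsilon> * k) \<le> m\<^sup>2"
proof -
  have "0 \<le> (h - \<epsilon>) * k" using assms by linarith
  then have "d * (d + \<epsilon> * k) \<le> ((h - \<epsilon>) * k) * (h * k)"
    using assms by (intro mult_mono) (auto simp: left_diff_distrib)
  also have "\<dots> = (h * k)\<^sup>2 - h * (\<epsilon> * k\<^sup>2)" by (simp add: algebra_simps power2_eq_square)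
  also have "\<dots> \<le> (h * k)\<^sup>2 - h * (2 * r)"
    using assms by (intro diff_left_mono mult_left_mono) auto
  also have "\<dots> \<le> (h * k - r / k)\<^sup>2" using \<open>0 < k\<close> by (simp add: power2_diff)
  also have "\<dots> \<le> m\<^sup>2" using assms by (intro power_mono)
  finally show ?thesis .
qed

lemma ratio_increase_if_small_entry:
  fixes k \<epsilon> a m m' :: real
  assumes "k \<ge> 2" "0 < \<epsilon>" "\<epsilon> \<le> 1" "\<epsilon> * k \<ge> 2" "m \<ge> k / 4" "0 \<le> a"
    and a_le: "a * (k * (1 + \<epsilon>)) \<le> 1" and m'_ge: "m - 2 * m * a \<le> m' * (1 - a)"
  shows "m / k + \<epsilon> / (16 * (k - 1)) \<le> m' / (k - 1)"
proof -
  define b where "b = k * (1 + \<epsilon>) - 1"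
  have "\<epsilon> * k \<le> k" using mult_right_mono[OF \<open>\<epsilon> \<le> 1\<close>, of k] \<open>k \<ge> 2\<close> by simp
  moreover have "b = k + \<epsilon> * k - 1" by (simp add: b_def algebra_simps)
  ultimately have b_bounds: "k \<le> b" "b \<le> 2 * k" "b > 0" "b - k = \<epsilon> * k - 1"
    using assms(1,4) by linarith+
  have "m > 0" using assms by linarith
  have "a * 2 \<le> a * (k * (1 + \<epsilon>))"
    using b_bounds assms by (intro mult_left_mono) (auto simp: b_def)
  then have "a < 1" using a_le by linarith
  have "m * (a * (b + 1)) \<le> m * 1" using a_le \<open>m > 0\<close> by (intro mult_left_mono) (auto simp: b_def)
  then have "(m - m / b) * (1 - a) \<le> m - 2 * m * a" using b_bounds by (simp add: field_simps)
  also note m'_ge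
  finally have delete: "m - m / b \<le> m'" using \<open>a < 1\<close> by simp
  have "\<epsilon> / 16 = (k / 4 * (\<epsilon> * k / 2)) / (k * (2 * k))" using assms by simp
  also have "\<dots> \<le> (m * (\<epsilon> * k - 1)) / (k * b)"
    using assms b_bounds \<open>m > 0\<close> by (intro frac_le mult_mono mult_nonneg_nonneg mult_pos_pos) auto
  also have "\<dots> = m / k - m / b"
    unfolding b_bounds(4)[symmetric] using \<open>k \<ge> 2\<close> b_bounds(3) by (simp add: field_simps)
  finally have "m - m / k + \<epsilon> / 16 \<le> m'" using delete by linarith
  then have "(m - m / k + \<epsilon> / 16) / (k - 1) \<le> m' / (k - 1)"
    using assms by (intro divide_right_mono) auto
  also have "(m - m / k + \<epsilon> / 16) / (k - 1) = m / k + \<epsilon> / (16 * (k - 1))"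
    using assms by (simp add: divide_simps) (simp add: algebra_simps)
  finally show ?thesis .
qed

lemma delete_low_degree_vertex:
  fixes k \<epsilon> :: real and r :: nat
  assumes "sym E" "irrefl E" "r \<ge> 2" "finite W" "u \<in> W" and k_eq: "k = card W"
    and \<epsilon>_bounds: "0 < \<epsilon>" "\<epsilon> \<le> 1 / 2" "\<epsilon> * k \<ge> 2" "\<epsilon> * k\<^sup>2 \<ge> 2 * r"
    and top: "top_eigenvalue W E \<ge> (1 - 1 / r) * k - r / k"
    and low: "card (W \<inter> E `` {u}) \<le> (1 - 1 / r - \<epsilon>) * k"
  shows "\<exists>w\<in>W. W - {w} \<noteq> {} \<and>
    top_eigenvalue W E / k + \<epsilon> / (16 * (k - 1)) \<le> top_eigenvalue (W - {w}) E / (k - 1)"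
proof -
  have "W \<noteq> {}" using \<open>u \<in> W\<close> by auto
  define m where "m = top_eigenvalue W E"
  define h where "h = 1 - 1 / real r"
  have h_bounds: "1 / 2 \<le> h" "h \<le> 1" using \<open>r \<ge> 2\<close> by (auto simp: h_def field_simps)
  have "\<epsilon> * k \<le> 1 / 2 * k" "\<epsilon> * k\<^sup>2 \<le> 1 / 2 * k\<^sup>2"
    using \<epsilon>_bounds(2) by (rule mult_right_mono, simp add: k_eq)+
  then have "k \<ge> 4" "4 * r \<le> k\<^sup>2" using \<epsilon>_bounds by linarith+
  then have "r / k \<le> k / 4" by (simp add: field_simps power2_eq_square)
  moreover have "k / 2 \<le> h * k" using h_bounds \<open>k \<ge> 4\<close> by simp
  moreover have m_ge: "h * k - r / k \<le> m" using top by (simp add: h_def m_def)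
  ultimately have m_bounds: "k / 4 \<le> m" "0 \<le> h * k - r / k" "m > 0" using \<open>k \<ge> 4\<close> by linarith+
  have product: "card (W \<inter> E `` {u}) * (card (W \<inter> E `` {u}) + \<epsilon> * card W) \<le> m\<^sup>2"
    unfolding k_eq[symmetric] using \<epsilon>_bounds h_bounds m_ge m_bounds low \<open>k \<ge> 4\<close>
    by (intro low_degree_product_le[where h = h and r = r]) (auto simp: h_def)
  obtain x where nonneg: "\<And>v. 0 \<le> x v" and norm: "(\<Sum>v\<in>W. (x v)\<^sup>2) = 1"
    and eigenvector: "\<And>u. u \<in> W \<Longrightarrow> adj_sum W E x u = m * x u"
    using ex_top_eigenvector[OF \<open>finite W\<close> \<open>W \<noteq> {}\<close> \<open>sym E\<close>] unfolding m_def by blast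
  obtain w where "w \<in> W" and small: "(x w)\<^sup>2 * (k * (1 + \<epsilon>)) \<le> 1"
    using ex_small_eigenvector_entry[OF assms(4,5) nonneg norm eigenvector[OF \<open>u \<in> W\<close>]
        m_bounds(3) product] k_eq
    by blast
  have "W - {w} \<noteq> {}"
  proof
    assume "W - {w} = {}"
    then have "W = {w}" using \<open>w \<in> W\<close> by auto
    then show False using \<open>k \<ge> 4\<close> by (simp add: k_eq)
  qed
  then have "m - 2 * m * (x w)\<^sup>2 \<le> top_eigenvalue (W - {w}) E * (1 - (x w)\<^sup>2)"
    using assms \<open>w \<in> W\<close> norm eigenvector by (intro top_eigenvalue_delete_ge) (auto simp: irrefl_def)
  then have "m / k + \<epsilon> / (16 * (k - 1)) \<le> top_eigenvalue (W - {w}) E / (k - 1)"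
    using \<open>k \<ge> 4\<close> \<epsilon>_bounds m_bounds small
    by (intro ratio_increase_if_small_entry[where a = "(x w)\<^sup>2"]) auto
  then show ?thesis using \<open>w \<in> W\<close> \<open>W - {w} \<noteq> {}\<close> by (auto simp: m_def)
qed

definition spectral_potential :: "real \<Rightarrow> 'a set \<Rightarrow> 'a rel \<Rightarrow> real" where
  "spectral_potential \<eta> V E = top_eigenvalue V E / card V + \<eta> * ln (card V)"

definition potential_maximizer :: "real \<Rightarrow> 'a set \<Rightarrow> 'a rel \<Rightarrow> 'a set \<Rightarrow> bool" where
  "potential_maximizer \<eta> V E W \<longleftrightarrow> W \<subseteq> V \<and> W \<noteq> {} \<and>
     (\<forall>U. U \<subseteq> V \<longrightarrow> U \<noteq> {} \<longrightarrow> spectral_potential \<eta> U E \<le> spectral_potential \<eta> W E)"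

lemma ex_potential_maximizer:
  assumes "finite V" "V \<noteq> {}"
  shows "\<exists>W. potential_maximizer \<eta> V E W"
proof -
  let ?P = "{W. W \<subseteq> V \<and> W \<noteq> {}}" and ?F = "\<lambda>W. spectral_potential \<eta> W E"
  have finite_nonempty: "finite (?F ` ?P)" "?F ` ?P \<noteq> {}" using assms by auto
  obtain W where "W \<in> ?P" "Max (?F ` ?P) = ?F W" using Max_in[OF finite_nonempty] by blast
  then show ?thesis
    using Max_ge[OF finite_nonempty(1)] by (intro exI[of _ W]) (auto simp: potential_maximizer_def)
qed

lemma ln_card_potential_maximizer_ge:
  assumes max: "potential_maximizer \<eta> V E W" and "finite V" "V \<noteq> {}" "sym E" "\<eta> > 0"
  shows "ln (card V) - 1 / \<eta> \<le> ln (card W)"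
proof -
  have W_subset: "finite W" "W \<noteq> {}"
    using max \<open>finite V\<close> by (auto simp: potential_maximizer_def intro: finite_subset)
  have "0 \<le> top_eigenvalue V E / card V" using assms by (simp add: top_eigenvalue_nonneg)
  moreover have "top_eigenvalue W E / card W \<le> 1"
    using top_eigenvalue_le_card[OF W_subset \<open>sym E\<close>] W_subset
    by (simp add: divide_le_eq card_gt_0_iff)
  moreover have "spectral_potential \<eta> V E \<le> spectral_potential \<eta> W E"
    using max \<open>V \<noteq> {}\<close> by (auto simp: potential_maximizer_def)
  ultimately have "\<eta> * ln (card V) \<le> 1 + \<eta> * ln (card W)" by (simp add: spectral_potential_def)
  then show ?thesis using \<open>\<eta> > 0\<close> by (simp add: field_simps)
qed

lemma top_eigenvalue_potential_maximizer_gt: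
  fixes \<eta> h \<rho> :: real
  assumes max: "potential_maximizer \<eta> V E W" and "finite V" "W \<noteq> V" "\<eta> > 0"
    and top: "top_eigenvalue V E \<ge> h * card V - \<rho>" and "\<rho> < \<eta>"
  shows "h * card W < top_eigenvalue W E"
proof -
  define n where "n = real (card V)"
  define k where "k = real (card W)"
  have W_proper: "W \<subset> V" "W \<noteq> {}" using max \<open>W \<noteq> V\<close> by (auto simp: potential_maximizer_def)
  then have "card W < card V" "0 < card W"
    using \<open>finite V\<close> by (auto simp: psubset_card_mono card_gt_0_iff intro: finite_subset)
  then have k_bounds: "k \<le> n - 1" "0 < k" "0 < n" by (simp_all add: n_def k_def)
  have "ln k - ln n \<le> (k - n) / n" using k_bounds by (intro ln_diff_le) auto
  also have "\<dots> \<le> - 1 / n" using k_bounds by (intro divide_right_mono) auto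
  finally have "\<eta> * (1 / n) \<le> \<eta> * (ln n - ln k)" using \<open>\<eta> > 0\<close> by (intro mult_left_mono) auto
  moreover have "spectral_potential \<eta> V E \<le> spectral_potential \<eta> W E"
    using max W_proper by (auto simp: potential_maximizer_def)
  ultimately have "top_eigenvalue V E / n + \<eta> / n \<le> top_eigenvalue W E / k"
    by (simp add: spectral_potential_def algebra_simps flip: n_def k_def)
  moreover have "h < (top_eigenvalue V E + \<eta>) / n"
    using top \<open>\<rho> < \<eta>\<close> k_bounds by (simp add: less_divide_eq flip: n_def)
  ultimately have "h < top_eigenvalue W E / k" by (simp add: add_divide_distrib)
  then show ?thesis using k_bounds by (simp add: less_divide_eq flip: k_def)
qed

lemma spectral_potential_less_delete:
  fixes \<epsilon> :: real
  assumes "finite W" "w \<in> W" "W - {w} \<noteq> {}" "0 < \<epsilon>"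
  defines "k \<equiv> real (card W)"
  assumes "top_eigenvalue W E / k + \<epsilon> / (16 * (k - 1)) \<le> top_eigenvalue (W - {w}) E / (k - 1)"
  shows "spectral_potential (\<epsilon> / 32) W E < spectral_potential (\<epsilon> / 32) (W - {w}) E"
proof -
  have "0 < card (W - {w})" unfolding card_gt_0_iff using assms by simp
  moreover have "card (W - {w}) + 1 = card W"
    using card_Suc_Diff1[OF assms(1,2)] by (simp only: Suc_eq_plus1)
  ultimately have card: "real (card (W - {w})) = k - 1" "0 < k - 1"
    by (simp_all add: k_def flip: of_nat_Suc)
  have "ln k - ln (k - 1) \<le> 1 / (k - 1)" using ln_diff_le[of k "k - 1"] card by simp
  then have "\<epsilon> / 32 * (ln k - ln (k - 1)) \<le> \<epsilon> / 32 * (1 / (k - 1))"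
    using \<open>0 < \<epsilon>\<close> by (intro mult_left_mono) auto
  also have "\<dots> < \<epsilon> / (16 * (k - 1))" using \<open>0 < \<epsilon>\<close> card by (simp add: field_simps)
  finally show ?thesis
    using assms(6) unfolding spectral_potential_def card(1) k_def[symmetric] right_diff_distrib
    by linarith
qed

lemma min_degree_potential_maximizer:
  fixes \<epsilon> :: real and r :: nat
  assumes max: "potential_maximizer (\<epsilon> / 32) V E W" and "finite V" "sym E" "irrefl E"
    and "r \<ge> 2" "u \<in> W"
    and \<epsilon>_bounds: "0 < \<epsilon>" "\<epsilon> \<le> 1 / 2" "2 * r \<le> \<epsilon> * card W"
    and "top_eigenvalue W E \<ge> (1 - 1 / r) * card W - r / card W"
  shows "(1 - 1 / r - \<epsilon>) * card W < card (W \<inter> E `` {u})"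
proof (rule ccontr)
  assume low: "\<not> ?thesis"
  have W_subset: "W \<subseteq> V" "W \<noteq> {}" "finite W"
    using max \<open>finite V\<close> by (auto simp: potential_maximizer_def intro: finite_subset)
  define k where "k = real (card W)"
  have "k \<ge> 1" using W_subset by (simp add: k_def Suc_le_eq card_gt_0_iff)
  have "\<epsilon> * k * 1 \<le> \<epsilon> * k * k" using \<open>k \<ge> 1\<close> \<epsilon>_bounds by (intro mult_left_mono) auto
  then have "2 \<le> \<epsilon> * k" "2 * r \<le> \<epsilon> * k\<^sup>2"
    using \<epsilon>_bounds(3) \<open>r \<ge> 2\<close> by (auto simp: power2_eq_square simp flip: k_def)
  then have "\<exists>w\<in>W. W - {w} \<noteq> {} \<and>
      top_eigenvalue W E / k + \<epsilon> / (16 * (k - 1)) \<le> top_eigenvalue (W - {w}) E / (k - 1)"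
    using assms W_subset low by (intro delete_low_degree_vertex) (auto simp: k_def)
  then obtain w where deletable: "w \<in> W" "W - {w} \<noteq> {}"
    and ratio: "top_eigenvalue W E / k + \<epsilon> / (16 * (k - 1)) \<le> top_eigenvalue (W - {w}) E / (k - 1)"
    by blast
  have "spectral_potential (\<epsilon> / 32) W E < spectral_potential (\<epsilon> / 32) (W - {w}) E"
    using W_subset(3) deletable \<epsilon>_bounds(1) ratio unfolding k_def
    by (rule spectral_potential_less_delete)
  moreover have "W - {w} \<subseteq> V" using W_subset(1) by auto
  ultimately show False using max deletable(2) unfolding potential_maximizer_def by (meson not_le)
qed

lemma ex_large_min_degree_subset:
  fixes \<epsilon> :: real and r :: nat
  assumes "sym E" "irrefl E" "finite V" "r \<ge> 2" and \<epsilon>_bounds: "0 < \<epsilon>" "\<epsilon> \<le> 1 / 2"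
    and top: "top_eigenvalue V E \<ge> (1 - 1 / r) * card V - r / card V"
    and size: "2 * r / \<epsilon> * exp (32 / \<epsilon>) \<le> card V"
  shows "\<exists>W\<subseteq>V. W \<noteq> {} \<and> card V \<le> card W * exp (32 / \<epsilon>) \<and>
    (\<forall>u\<in>W. (1 - 1 / r - \<epsilon>) * card W < card (W \<inter> E `` {u})) \<and>
    (W = V \<or> (1 - 1 / r) * card W < top_eigenvalue W E)"
proof -
  have "64 \<le> 32 / \<epsilon>" using \<epsilon>_bounds by (simp add: field_simps)
  also have "\<dots> \<le> exp (32 / \<epsilon>)" using exp_ge_add_one_self[of "32 / \<epsilon>"] by linarith
  finally have "2 * r / \<epsilon> * 64 \<le> 2 * r / \<epsilon> * exp (32 / \<epsilon>)"
    using \<epsilon>_bounds by (intro mult_left_mono) auto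
  then have order_ge: "128 * r \<le> \<epsilon> * card V" using size \<epsilon>_bounds by (simp add: field_simps)
  then have "card V > 0" using \<open>r \<ge> 2\<close> by (intro gr0I) simp
  then have "V \<noteq> {}" by auto
  then obtain W where max: "potential_maximizer (\<epsilon> / 32) V E W"
    using ex_potential_maximizer \<open>finite V\<close> by blast
  then have W_subset: "W \<subseteq> V" "W \<noteq> {}" "card W > 0"
    using \<open>finite V\<close> by (auto simp: potential_maximizer_def card_gt_0_iff intro: finite_subset)
  have "ln (card V) - 32 / \<epsilon> \<le> ln (card W)"
    using ln_card_potential_maximizer_ge[OF max \<open>finite V\<close> \<open>V \<noteq> {}\<close> \<open>sym E\<close>] \<epsilon>_bounds by simp
  then have "exp (ln (card V) - 32 / \<epsilon>) \<le> exp (ln (card W))" by simp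
  then have card: "card V \<le> card W * exp (32 / \<epsilon>)"
    using \<open>card V > 0\<close> \<open>card W > 0\<close> by (simp add: exp_diff divide_le_eq)
  with size have "2 * r / \<epsilon> * exp (32 / \<epsilon>) \<le> card W * exp (32 / \<epsilon>)" by linarith
  then have "2 * r / \<epsilon> \<le> card W" by (rule mult_right_le_imp_le) simp
  then have large: "2 * r \<le> \<epsilon> * card W" using \<epsilon>_bounds by (simp add: field_simps)
  have "r / card V < \<epsilon> / 32" using order_ge \<open>card V > 0\<close> \<open>r \<ge> 2\<close> by (simp add: field_simps)
  then have dense: "W = V \<or> (1 - 1 / r) * card W < top_eigenvalue W E"
    using top_eigenvalue_potential_maximizer_gt[OF max \<open>finite V\<close> _ _ top] \<epsilon>_bounds by auto
  have "0 \<le> r / real (card W)" by simp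
  then have "top_eigenvalue W E \<ge> (1 - 1 / r) * card W - r / card W"
    using dense top by (elim disjE) (simp, linarith)
  then have "(1 - 1 / r - \<epsilon>) * card W < card (W \<inter> E `` {u})" if "u \<in> W" for u
    using assms max large that by (intro min_degree_potential_maximizer)
  then show ?thesis using W_subset card dense by (intro exI[of _ W]) auto
qed

section \<open>Embedding the multipartite graph with an extra edge\<close>

lemma ex_distinct_list_subset:
  assumes "s \<le> card P"
  shows "\<exists>xs. distinct xs \<and> length xs = s \<and> set xs \<subseteq> P"
proof -
  obtain T where "T \<subseteq> P" "card T = s" "finite T"
    using obtain_subset_with_card_n[OF assms] by blast
  then show ?thesis using finite_distinct_list[of T] distinct_card by metis
qed

lemma ex_distinct_list_subset_Cons_Cons:
  assumes "s + 2 \<le> card P" "u \<in> P" "w \<in> P" "u \<noteq> w"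
  shows "\<exists>xs. distinct (u # w # xs) \<and> length xs = s \<and> set (u # w # xs) \<subseteq> P"
proof -
  have "s \<le> card (P - {u, w})" using assms by (simp add: card_Diff_subset)
  then obtain xs where "distinct xs" "length xs = s" "set xs \<subseteq> P - {u, w}"
    using ex_distinct_list_subset by metis
  then show ?thesis using assms by (intro exI[of _ xs]) auto
qed

lemma contains_multipartite_plus_first_part:
  assumes "contains_multipartite_plus E r s"
  shows "\<exists>P. mutually_joined E P {..<r} \<and> (\<forall>i<r. s \<le> card (P i)) \<and> (\<exists>u\<in>P 0. \<exists>w\<in>P 0. (u, w) \<in> E)"
proof -
  obtain P k where joined: "mutually_joined E P {..<r}" and card: "\<forall>i<r. s \<le> card (P i)"
    and "k < r" and edge: "\<exists>u\<in>P k. \<exists>w\<in>P k. (u, w) \<in> E"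
    using assms unfolding contains_multipartite_plus_def by blast
  define \<sigma> where "\<sigma> i = (if i = 0 then k else if i = k then 0 else i)" for i
  have "mutually_joined E (\<lambda>i. P (\<sigma> i)) {..<r}"
  proof (rule mutually_joinedI)
    fix i j u v assume "i \<in> {..<r}" "j \<in> {..<r}" "i \<noteq> j" "u \<in> P (\<sigma> i)" "v \<in> P (\<sigma> j)"
    then show "(u, v) \<in> E"
      using \<open>k < r\<close> by (intro mutually_joinedD[OF joined, of "\<sigma> i" "\<sigma> j"]) (auto simp: \<sigma>_def)
  qed
  moreover have "s \<le> card (P (\<sigma> i))" if "i < r" for i using card \<open>k < r\<close> that by (auto simp: \<sigma>_def)
  moreover have "\<sigma> 0 = k" by (simp add: \<sigma>_def)
  ultimately show ?thesis using edge by (intro exI[of _ "\<lambda>i. P (\<sigma> i)"]) simp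
qed

lemma contains_multipartite_plus_imp_embedding:
  assumes "irrefl E" "contains_multipartite_plus E r s" "r > 0" "s \<ge> 2"
  shows "\<exists>f. inj_on f ({..<r} \<times> {..<s}) \<and> (f (0, 0), f (0, 1)) \<in> E \<and>
    (\<forall>i<r. \<forall>j<r. \<forall>a<s. \<forall>b<s. i \<noteq> j \<longrightarrow> (f (i, a), f (j, b)) \<in> E)"
proof -
  obtain P u w where joined: "mutually_joined E P {..<r}" and card: "\<And>i. i < r \<Longrightarrow> s \<le> card (P i)"
    and edge: "u \<in> P 0" "w \<in> P 0" "(u, w) \<in> E"
    using contains_multipartite_plus_first_part[OF assms(2)] by blast
  have "u \<noteq> w" using edge \<open>irrefl E\<close> by (auto simp: irrefl_def)
  moreover have "s - 2 + 2 \<le> card (P 0)" using card[of 0] assms by simp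
  ultimately obtain ys where "distinct (u # w # ys)" "length ys = s - 2" "set (u # w # ys) \<subseteq> P 0"
    using ex_distinct_list_subset_Cons_Cons edge(1,2) by metis
  then have first_list: "distinct (u # w # ys)" "length (u # w # ys) = s" "set (u # w # ys) \<subseteq> P 0"
    using \<open>s \<ge> 2\<close> by auto
  have "\<exists>xs. distinct xs \<and> length xs = s \<and> set xs \<subseteq> P i" if "i < r" for i
    using card[OF that] by (rule ex_distinct_list_subset)
  then obtain xs
    where part_list: "\<And>i. i < r \<Longrightarrow> distinct (xs i) \<and> length (xs i) = s \<and> set (xs i) \<subseteq> P i"
    by metis
  define ps where "ps i = (if i = 0 then u # w # ys else xs i)" for i
  define f where "f = (\<lambda>(i, a). ps i ! a)"
  have parts: "distinct (ps i)" "length (ps i) = s" "set (ps i) \<subseteq> P i" if "i < r" for i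
    using part_list[OF that] first_list by (auto simp: ps_def)
  then have "f (i, a) \<in> P i" if "i < r" "a < s" for i a
    using that by (auto simp: f_def subset_iff)
  then have adj: "(f (i, a), f (j, b)) \<in> E" if "i < r" "j < r" "i \<noteq> j" "a < s" "b < s" for i j a b
    using mutually_joinedD[OF joined] that by simp
  have "inj_on f ({..<r} \<times> {..<s})"
  proof (rule inj_onI, clarsimp)
    fix i a j b assume same_vertex: "i < r" "a < s" "j < r" "b < s" "f (i, a) = f (j, b)"
    then have "i = j" using adj[of i j a b] \<open>irrefl E\<close> by (auto simp: irrefl_def)
    then show "i = j \<and> a = b"
      using same_vertex parts[of i] by (auto simp: f_def nth_eq_iff_index_eq)
  qed
  moreover have "(f (0, 0), f (0, 1)) \<in> E" using edge by (simp add: f_def ps_def)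
  ultimately show ?thesis using adj by blast
qed

lemma embedding_imp_subgraph_iso:
  fixes G :: "'a pair_pre_digraph" and K :: "'b pair_pre_digraph"
  assumes "pair_wf_digraph G" "pair_wf_digraph K"
    and inj: "inj_on f (pverts K)" and verts: "f ` pverts K \<subseteq> pverts G"
    and arcs: "\<And>u v. (u, v) \<in> parcs K \<Longrightarrow> (f u, f v) \<in> parcs G"
  shows "\<exists>H. subgraph H (with_proj G) \<and> digraph_iso H (with_proj K)"
proof -
  interpret G: pair_wf_digraph G by fact
  interpret K: pair_wf_digraph K by fact
  define hom where "hom = \<lparr>iso_verts = f, iso_arcs = map_prod f f,
    iso_head = (snd :: 'a \<times> 'a \<Rightarrow> 'a), iso_tail = (fst :: 'a \<times> 'a \<Rightarrow> 'a)\<rparr>"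
  define H where "H = app_iso hom (with_proj K)"
  have wf_K: "wf_digraph (with_proj K)" by unfold_locales
  have arcs_subset: "parcs K \<subseteq> pverts K \<times> pverts K" using K.in_arcsD1 K.in_arcsD2 by auto
  have "pre_digraph.digraph_isomorphism (with_proj K) hom"
    unfolding pre_digraph.digraph_isomorphism_def
    using wf_K inj inj_on_subset[OF map_prod_inj_on[OF inj inj]] arcs_subset by (auto simp: hom_def)
  then have "digraph_iso (with_proj K) H" unfolding digraph_iso_def H_def by blast
  then have "digraph_iso H (with_proj K)" by (rule digraph_iso_swap[OF wf_K])
  moreover have "subgraph H (with_proj G)"
    unfolding subgraph_def compatible_def H_def
    using verts arcs arcs_subset G.wf_digraph_axioms by (auto simp: hom_def wf_digraph_def)
  ultimately show ?thesis by blast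
qed

lemma (in pair_graph) sym_parcs: "sym (parcs G)"
  using sym_arcs by (auto simp: symmetric_def)

lemma (in pair_graph) irrefl_parcs: "irrefl (parcs G)"
  by (rule irreflI) (metis no_loops')

lemma contains_multipartite_plus_imp_subgraph:
  fixes G :: "'a pair_pre_digraph"
  assumes "pair_graph G" "contains_multipartite_plus (parcs G) r s" "r \<ge> 2" "s \<ge> 2"
  shows "\<exists>H. subgraph H (with_proj G) \<and>
    digraph_iso H (with_proj (complete_multipartite_plus (replicate r s)))"
proof -
  interpret G: pair_graph G by fact
  let ?K = "complete_multipartite_plus (replicate r s)"
  interpret K: pair_graph ?K
    by (rule pair_graph_complete_multipartite_plus) (use assms in auto)
  obtain f where inj: "inj_on f ({..<r} \<times> {..<s})" and edge: "(f (0, 0), f (0, 1)) \<in> parcs G"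
    and adj: "\<And>i j a b. i < r \<Longrightarrow> j < r \<Longrightarrow> a < s \<Longrightarrow> b < s \<Longrightarrow> i \<noteq> j \<Longrightarrow> (f (i, a), f (j, b)) \<in> parcs G"
    using contains_multipartite_plus_imp_embedding[OF G.irrefl_parcs assms(2)] assms by auto
  have verts: "pverts ?K = {..<r} \<times> {..<s}"
    by (auto simp: complete_multipartite_plus_def pverts_complete_multipartite)
  have "f (i, a) \<in> pverts G" if "i < r" "a < s" for i a
  proof -
    define j :: nat where "j = (if i = 0 then 1 else 0)"
    have "(f (i, a), f (j, a)) \<in> parcs G" using that \<open>r \<ge> 2\<close> by (intro adj) (auto simp: j_def)
    then show ?thesis using G.in_arcsD1 by blast
  qed
  then have "f ` pverts ?K \<subseteq> pverts G" by (auto simp: verts)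
  moreover have "(f u, f v) \<in> parcs G" if "(u, v) \<in> parcs ?K" for u v
    using that edge adj symD[OF G.sym_parcs edge]
    by (auto simp: complete_multipartite_plus_def parcs_complete_multipartite
        pverts_complete_multipartite)
  ultimately show ?thesis
    using inj unfolding verts[symmetric]
    by (intro embedding_imp_subgraph_iso G.pair_wf_digraph_axioms K.pair_wf_digraph_axioms)
qed

section \<open>The theorem\<close>

lemma square_le_four_power:
  fixes r s :: nat
  assumes "r > 0" "s > 0"
  shows "5 * r\<^sup>2 \<le> 4 ^ (64 * r\<^sup>2 * s * (2 * r) ^ r)"
proof -
  have "5 * r\<^sup>2 * 1 \<le> 64 * r\<^sup>2 * (s * (2 * r) ^ r)"
    using assms by (intro mult_mono) auto
  also have "\<dots> = 64 * r\<^sup>2 * s * (2 * r) ^ r" by (simp only: mult.assoc)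
  also have "\<dots> \<le> 4 ^ (64 * r\<^sup>2 * s * (2 * r) ^ r)"
    using power_gt_expt[of 4 "64 * r\<^sup>2 * s * (2 * r) ^ r"] by simp
  finally show ?thesis by simp
qed

lemma ex_large_subset_few_nonneighbours:
  fixes r N :: nat
  assumes "sym E" "irrefl E" "finite V" "r \<ge> 2"
    and size: "32 * r\<^sup>2 * 4 ^ N * exp (2560 * r ^ 3) \<le> card V" and power_ge: "5 * r\<^sup>2 \<le> 4 ^ N"
    and top: "top_eigenvalue V E \<ge> (1 - 1 / r) * card V - r / card V"
  shows "\<exists>W\<subseteq>V. W \<noteq> {} \<and> 32 * r\<^sup>2 * 4 ^ N \<le> card W \<and>
    (\<forall>v\<in>W. card (W - E `` {v}) \<le> (1 / r + 1 / (80 * r ^ 3)) * card W) \<and>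
    (W = V \<or> (1 - 1 / r) * card W < top_eigenvalue W E)"
proof -
  define \<epsilon> where "\<epsilon> = 1 / (80 * real r ^ 3)"
  have "2 ^ 3 \<le> real r ^ 3" using \<open>r \<ge> 2\<close> by (intro power_mono) auto
  then have \<epsilon>_bounds: "0 < \<epsilon>" "\<epsilon> \<le> 1 / 2" using \<open>r \<ge> 2\<close> by (simp_all add: \<epsilon>_def)
  have size: "32 * r\<^sup>2 * 4 ^ N * exp (32 / \<epsilon>) \<le> card V" using size by (simp add: \<epsilon>_def)
  have "2 * r / \<epsilon> = 32 * (real r)\<^sup>2 * real (5 * r\<^sup>2)"
    by (simp add: \<epsilon>_def power2_eq_square power3_eq_cube)
  also have "\<dots> \<le> 32 * (real r)\<^sup>2 * real (4 ^ N)"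
    using power_ge by (intro mult_left_mono) (simp_all only: of_nat_le_iff, simp)
  finally have "2 * r / \<epsilon> * exp (32 / \<epsilon>) \<le> 32 * r\<^sup>2 * 4 ^ N * exp (32 / \<epsilon>)"
    by (intro mult_right_mono) simp_all
  then have "2 * r / \<epsilon> * exp (32 / \<epsilon>) \<le> card V" using size by linarith
  then obtain W where W_subset: "W \<subseteq> V" "W \<noteq> {}" and card_W: "card V \<le> card W * exp (32 / \<epsilon>)"
    and degree: "\<And>u. u \<in> W \<Longrightarrow> (1 - 1 / r - \<epsilon>) * card W < card (W \<inter> E `` {u})"
    and dense: "W = V \<or> (1 - 1 / r) * card W < top_eigenvalue W E"
    using ex_large_min_degree_subset[OF assms(1-4) \<epsilon>_bounds top] by blast
  have "finite W" using W_subset(1) \<open>finite V\<close> by (rule finite_subset)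
  then have "card (W - E `` {v}) \<le> (1 / r + 1 / (80 * r ^ 3)) * card W" if "v \<in> W" for v
    using degree[OF that] real_card_Diff[of W "E `` {v}"]
    by (simp add: \<epsilon>_def left_diff_distrib distrib_right)
  moreover have "32 * r\<^sup>2 * 4 ^ N \<le> card W"
  proof -
    have "32 * r\<^sup>2 * 4 ^ N * exp (32 / \<epsilon>) \<le> card W * exp (32 / \<epsilon>)" using size card_W by linarith
    then have "32 * r\<^sup>2 * 4 ^ N \<le> real (card W)" by (rule mult_right_le_imp_le) simp
    then have "real (32 * r\<^sup>2 * 4 ^ N) \<le> real (card W)" by simp
    then show ?thesis by (simp only: of_nat_le_iff)
  qed
  ultimately show ?thesis using W_subset dense by (intro exI[of _ W]) auto
qed

theorem contains_multipartite_plus_if_top_eigenvalue_gt_turan: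
  fixes E :: "'a rel" and V :: "'a set" and r s :: nat
  assumes "sym E" "irrefl E" "finite V" "r \<ge> 2" "s > 0"
    and size: "32 * r\<^sup>2 * 4 ^ (64 * r\<^sup>2 * s * (2 * r) ^ r) * exp (2560 * r ^ 3) \<le> card V"
    and gt_turan: "largest_eigenvalue (turan_graph r (card V)) < top_eigenvalue V E"
  shows "contains_multipartite_plus E r s"
proof (rule ccontr)
  assume free: "\<not> contains_multipartite_plus E r s"
  have "0 < 32 * r\<^sup>2 * 4 ^ (64 * r\<^sup>2 * s * (2 * r) ^ r) * exp (2560 * r ^ 3)"
    using \<open>r \<ge> 2\<close> by (intro mult_pos_pos) auto
  then have "card V > 0" using size by linarith
  then have top: "(1 - 1 / r) * card V - r / card V \<le> top_eigenvalue V E"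
    using largest_eigenvalue_turan_graph_ge[of r "card V"] \<open>r \<ge> 2\<close> gt_turan by simp
  have "5 * r\<^sup>2 \<le> 4 ^ (64 * r\<^sup>2 * s * (2 * r) ^ r)"
    using \<open>r \<ge> 2\<close> \<open>s > 0\<close> by (intro square_le_four_power) auto
  then obtain W where W_subset: "W \<subseteq> V" "W \<noteq> {}"
    and card_W: "32 * r\<^sup>2 * 4 ^ (64 * r\<^sup>2 * s * (2 * r) ^ r) \<le> card W"
    and miss: "\<And>v. v \<in> W \<Longrightarrow> card (W - E `` {v}) \<le> (1 / r + 1 / (80 * r ^ 3)) * card W"
    and dense: "W = V \<or> (1 - 1 / r) * card W < top_eigenvalue W E"
    using ex_large_subset_few_nonneighbours[OF assms(1-4) size _ top] by blast
  have "finite W" using W_subset(1) \<open>finite V\<close> by (rule finite_subset)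
  then obtain p where coloring: "p \<in> W \<rightarrow> {..<r}" "proper_coloring W E p"
    using ex_proper_coloring_if_plus_free[OF \<open>sym E\<close> _ \<open>r \<ge> 2\<close> \<open>s > 0\<close> miss card_W free] by blast
  have "top_eigenvalue W E \<le> (1 - 1 / r) * card W"
    using top_eigenvalue_proper_coloring_le[OF \<open>finite W\<close> W_subset(2) \<open>sym E\<close> _ coloring] by simp
  then have "W = V" using dense by auto
  moreover have "top_eigenvalue W E \<le> largest_eigenvalue (turan_graph r (card W))"
    using \<open>finite W\<close> W_subset(2) \<open>sym E\<close> coloring by (rule top_eigenvalue_proper_coloring_le_turan)
  ultimately show False using gt_turan by simp
qed

lemma mult_power_le_power:
  fixes a x :: real
  assumes "2 \<le> x" "a \<le> 2 ^ j" "j + b \<le> k"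
  shows "a * x ^ b \<le> x ^ k"
proof -
  have "a \<le> x ^ j" using assms(2) power_mono[OF \<open>2 \<le> x\<close>, of j] by simp
  then have "a * x ^ b \<le> x ^ j * x ^ b" using \<open>2 \<le> x\<close> by (intro mult_right_mono) auto
  also have "\<dots> = x ^ (j + b)" by (simp add: power_add)
  also have "\<dots> \<le> x ^ k" using assms by (intro power_increasing) auto
  finally show ?thesis .
qed

lemma part_exponent_ge:
  fixes r :: nat
  assumes "r \<ge> 2"
  shows "15 \<le> (2 * r + 9) * (r + 1)" "11 + 2 * r \<le> (2 * r + 9) * (r + 1)"
proof -
  have product_ge: "(2 * r + 9) * 3 \<le> (2 * r + 9) * (r + 1)"
    using assms by (intro mult_left_mono) auto
  show "15 \<le> (2 * r + 9) * (r + 1)" "11 + 2 * r \<le> (2 * r + 9) * (r + 1)"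
    by (rule order_trans[OF _ product_ge], use assms in simp)+
qed

lemma trace_exponent_le:
  fixes r s :: nat
  assumes "r \<ge> 2"
  shows "8 * real (64 * r\<^sup>2 * s * (2 * r) ^ r) \<le> real r ^ ((2 * r + 9) * (r + 1)) * s"
proof -
  have "real (2 * r) ^ r \<le> (real r ^ 2) ^ r"
    using assms by (intro power_mono) (simp_all add: power2_eq_square)
  also have "\<dots> = real r ^ (2 * r)" by (simp add: power_mult)
  finally have "8 * real (64 * r\<^sup>2 * s * (2 * r) ^ r) \<le> 512 * (real r)\<^sup>2 * s * real r ^ (2 * r)"
    by (simp add: mult_left_mono)
  also have "\<dots> = 512 * real r ^ (2 + 2 * r) * s" by (simp add: power_add power2_eq_square)
  also have "\<dots> \<le> real r ^ ((2 * r + 9) * (r + 1)) * s"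
    using assms part_exponent_ge[OF assms]
    by (intro mult_right_mono mult_power_le_power[where j = 9]) auto
  finally show ?thesis .
qed

lemma two_le_floor_mult_ln:
  fixes c x :: real
  assumes "c > 0" "exp (2 / c) \<le> x"
  shows "2 \<le> nat \<lfloor>c * ln x\<rfloor>"
proof -
  have "x > 0" using less_le_trans[OF exp_gt_zero assms(2)] .
  then have "2 / c \<le> ln x" using assms(2) by (simp add: ln_ge_iff)
  then have "2 \<le> c * ln x" using \<open>c > 0\<close> by (simp add: field_simps)
  then show ?thesis by (intro le_nat_floor) simp
qed

lemma part_size_le:
  fixes r n :: nat and c :: real
  assumes "r \<ge> 2" and c_eq: "c = 1 / real r ^ ((2 * r + 9) * (r + 1))"
    and n_ge: "real n \<ge> exp (2 / c)"
  defines "s \<equiv> nat \<lfloor>c * ln (real n)\<rfloor>"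
  shows "32 * r\<^sup>2 * 4 ^ (64 * r\<^sup>2 * s * (2 * r) ^ r) * exp (2560 * r ^ 3) \<le> n"
proof -
  define R where "R = real r"
  define k where "k = (2 * r + 9) * (r + 1)"
  define N where "N = 64 * r\<^sup>2 * s * (2 * r) ^ r"
  have "R \<ge> 2" using \<open>r \<ge> 2\<close> by (simp add: R_def)
  then have "R ^ k > 0" and c_inverse: "c = 1 / R ^ k" using c_eq by (simp_all add: R_def k_def)
  have "real n > 0" using less_le_trans[OF exp_gt_zero n_ge] .
  then have "2 / c \<le> ln n" using n_ge by (simp add: ln_ge_iff)
  then have ln_n_ge: "2 * R ^ k \<le> ln n" by (simp add: c_inverse)
  then have "0 \<le> c * ln n" using \<open>R ^ k > 0\<close> by (simp add: c_inverse)
  then have "s \<le> c * ln n" by (simp add: s_def)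
  then have "R ^ k * s \<le> ln n" using \<open>R ^ k > 0\<close> by (simp add: c_inverse field_simps)
  then have N_le: "8 * N \<le> ln n"
    using trace_exponent_le[OF \<open>r \<ge> 2\<close>, of s] unfolding N_def R_def k_def by linarith
  have "32 * R\<^sup>2 + 2560 * R ^ 3 \<le> 2576 * R ^ 3"
    using \<open>R \<ge> 2\<close> by (simp add: power2_eq_square power3_eq_cube)
  also have "\<dots> \<le> R ^ k"
    using part_exponent_ge(1)[OF \<open>r \<ge> 2\<close>] \<open>R \<ge> 2\<close>
    by (intro mult_power_le_power[where j = 12]) (auto simp: k_def)
  finally have exponent: "32 * R\<^sup>2 + N * 4 + 2560 * R ^ 3 \<le> ln n" using N_le ln_n_ge by linarith
  have "32 * R\<^sup>2 \<le> exp (32 * R\<^sup>2)" "4 \<le> exp (4 :: real)"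
    using exp_ge_add_one_self[of "32 * R\<^sup>2"] exp_ge_add_one_self[of "4 :: real"] by linarith+
  then have "32 * R\<^sup>2 * 4 ^ N * exp (2560 * R ^ 3) \<le>
      exp (32 * R\<^sup>2) * exp 4 ^ N * exp (2560 * R ^ 3)"
    by (intro mult_right_mono mult_mono power_mono) auto
  also have "\<dots> = exp (32 * R\<^sup>2 + N * 4 + 2560 * R ^ 3)" by (simp add: exp_add exp_of_nat_mult)
  also have "\<dots> \<le> exp (ln n)" using exponent by simp
  finally show ?thesis using \<open>real n > 0\<close> by (simp add: N_def R_def)
qed

theorem theorem3:
  fixes r n :: nat and c :: real and G :: "'a pair_pre_digraph"
  assumes "r \<ge> 2"
    and "c = 1 / real r ^ ((2 * r + 9) * (r + 1))"
    and "real n \<ge> exp (2 / c)"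
    and "pair_graph G"
    and "card (pverts G) = n"
    and "largest_eigenvalue G > largest_eigenvalue (turan_graph r n)"
  shows "\<exists>H. subgraph H (with_proj G) \<and>
    digraph_iso H (with_proj (complete_multipartite_plus (replicate r (nat \<lfloor>c * ln (real n)\<rfloor>))))"
proof -
  interpret G: pair_graph G by fact
  define s where "s = nat \<lfloor>c * ln (real n)\<rfloor>"
  have "c > 0" using assms(1,2) by simp
  then have "2 \<le> s" unfolding s_def using assms(3) by (rule two_le_floor_mult_ln)
  have "contains_multipartite_plus (parcs G) r s"
  proof (rule contains_multipartite_plus_if_top_eigenvalue_gt_turan[OF G.sym_parcs G.irrefl_parcs])
    show "largest_eigenvalue (turan_graph r (card (pverts G))) <
        top_eigenvalue (pverts G) (parcs G)"
      using assms(5,6) by (simp add: top_eigenvalue_graph)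
    show "32 * r\<^sup>2 * 4 ^ (64 * r\<^sup>2 * s * (2 * r) ^ r) * exp (2560 * r ^ 3) \<le> card (pverts G)"
      unfolding assms(5) s_def using assms(1-3) by (rule part_size_le)
  qed (use assms(1) \<open>2 \<le> s\<close> in auto)
  then show ?thesis
    unfolding s_def[symmetric] using assms(1,4) \<open>2 \<le> s\<close>
    by (intro contains_multipartite_plus_imp_subgraph)
qed

end
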